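(* Let $D$ be a diagram of an oriented link, and let $\alpha$ be a state cycle based on a state $\sigma$ of $D$. If $\alpha$ represents a nontrivial homology class in (rational) Khovanov homology, then all of the following hold: \begin{itemize} \item[(S1)] $\sigma$ is 0-merging. \item[(S2)] $\sigma$ has no 1-pinchtraces touching loops in its 1-block. \item[(L1)] Every 0-tracing loop of $\alpha$ is marked by $v_-$. \item[(L2)] No pair of loops both marked by $v_-$ is joined by only 1-traces (that is, there is no pair of distinct loops, both marked by $v_-$, such that at least one trace connects the two loops and all traces connecting them are 1-traces). \item[(L3)] Every loop in an odd connected component of the 1-block is marked by $v_+$. \item[(L4)] At most one loop in each even connected component of the 1-block is marked by $v_-$; all other loops in that component are marked by $v_+$. \end{itemize} Furthermore, subject to the requirement that no pair of distinct loops, both marked by $v_-$, is connected by at least one trace with all traces connecting them being 1-traces, changing which single loop is marked by $v_-$ in a fixed even connected component of the 1-block that has exactly one loop marked by $v_-$ and all its other loops marked by $v_+$ (keeping all other components and loops marked as before) only changes the sign of the resulting homology class.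
   Context: Khovanov complex (over $\mathbb{Q}$, Bar-Natan's conventions). Let $D$ be a diagram of an oriented link with an ordering of its crossings. Each crossing has a 0-smoothing and a 1-smoothing (standard convention; the orientation-consistent smoothing is the 0-smoothing at a positive crossing and the 1-smoothing at a negative crossing). A state $\sigma$ is a choice of smoothing at every crossing; it yields a collection of planar loops. Let $V=\langle v_+,v_-\rangle_{\mathbb{Q}}$. An enhanced state (ET state) based on $\sigma$ is a marking of each loop of $\sigma$ by $v_+$ or $v_-$, i.e. a basis element of $V^{\otimes k}$, $k$ the number of loops; the enhanced states form a basis of the chain complex. The differential is $d=\sum_e(-1)^{|e|}d_e$, where for a state $\sigma$ the edges $e$ leaving $\sigma$ correspond to changing one 0-smoothing of $\sigma$ to a 1-smoothing, $|e|$ is the number of 1-smoothed crossings preceding the changed crossing, and $d_e$ is the identity on unaffected loops and on the affected loops is: (two loops merge) $v_+\otimes v_+\mapsto v_+$, $v_+\otimes v_-\mapsto v_-$, $v_-\otimes v_+\mapsto v_-$, $v_-\otimes v_-\mapsto 0$; (one loop splits) $v_+\mapsto v_+\otimes v_-+v_-\otimes v_+$, $v_-\mapsto v_-\otimes v_-$. State cycles and traces. An enhanced state $\alpha$ is a state cycle if $d(\alpha)=0$, and is nontrivial if $[\alpha]\ne 0$ in Khovanov homology. Each crossing of $D$ leaves a trace in $\sigma$: an arc joining the two strands of the smoothing at the place where the crossing was. It is a 0-trace or 1-trace according to the smoothing. A trace is a mergetrace if it connects two distinct loops of $\sigma$ and a pinchtrace if both its ends lie on one loop; one speaks of 0-mergetraces,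 1-pinchtraces, etc. The state $\sigma$ is 0-merging if every 0-trace is a mergetrace. A loop is 0-tracing (1-tracing) if some 0-trace (1-trace) touches it. The 1-block of $\sigma$ is the set of loops that are 1-tracing but not 0-tracing. The 1-block graph $\Gamma_1$ has as vertices the loops of the 1-block and as edges the 1-traces between them. A connected component of the 1-block is the set of loops of a connected component of $\Gamma_1$; it is even if every circuit in that component of $\Gamma_1$ has even length and odd otherwise. *)

theory Defs
  imports Complex_Main "HOL-Library.Function_Algebras"
begin

text \<open>
  A crossing is given in planar-diagram notation: the four incident edges are listed
  counterclockwise, starting with the incoming lower (under) edge.  The upper strand runs from the
  fourth to the second edge at a positive crossing \<open>Xp\<close>, and from the second to the fourth edge at a
  negative crossing \<open>Xm\<close>.
\<close>

datatype crossing = Xp nat nat nat nat | Xm nat nat nat nat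

fun ends :: "crossing \<Rightarrow> nat list" where
  "ends (Xp i j k l) = [i, j, k, l]"
| "ends (Xm i j k l) = [i, j, k, l]"

fun incoming :: "crossing \<Rightarrow> nat set" where
  "incoming (Xp i j k l) = {0, 3}"
| "incoming (Xm i j k l) = {0, 1}"

text \<open>
  The ordering of the crossings is their order in the list.  An edge that is incident to no
  crossing is a crossingless circle component of the diagram.
\<close>

record link_diagram =
  crossings :: "crossing list"
  edges :: "nat set"

definition ncross :: "link_diagram \<Rightarrow> nat" where
  "ncross D = length (crossings D)"

text \<open>A dart \<open>(c, p)\<close> is the \<open>p\<close>-th edge end at the \<open>c\<close>-th crossing.\<close>

definition darts :: "link_diagram \<Rightarrow> (nat \<times> nat) set" where
  "darts D = {..<ncross D} \<times> {..<4}"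

definition dart_edge :: "link_diagram \<Rightarrow> nat \<times> nat \<Rightarrow> nat" where
  "dart_edge D = (\<lambda>(c, p). ends (crossings D ! c) ! p)"

definition in_darts :: "link_diagram \<Rightarrow> (nat \<times> nat) set" where
  "in_darts D = {(c, p) \<in> darts D. p \<in> incoming (crossings D ! c)}"

definition out_darts :: "link_diagram \<Rightarrow> (nat \<times> nat) set" where
  "out_darts D = darts D - in_darts D"

text \<open>The classes of the equivalence relation on \<open>A\<close> generated by \<open>R \<subseteq> A \<times> A\<close>.\<close>

definition gen_class :: "('a \<times> 'a) set \<Rightarrow> 'a \<Rightarrow> 'a set" where
  "gen_class R a = (R \<union> R\<inverse>)\<^sup>* `` {a}"

definition gen_classes :: "'a set \<Rightarrow> ('a \<times> 'a) set \<Rightarrow> 'a set set" where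
  "gen_classes A R = gen_class R ` A"

text \<open>
  The graph is the 4-valent one underlying the diagram.  Walking around a face, one follows an edge from one of its darts \<open>x\<close> to the opposite dart \<open>(c, p)\<close> and continues
  with the next dart in the cyclic order at \<open>c\<close>.
\<close>

definition graph_components :: "link_diagram \<Rightarrow> (nat \<times> nat) set set" where
  "graph_components D = gen_classes (darts D)
     {(x, y). x \<in> darts D \<and> y \<in> darts D \<and> (fst x = fst y \<or> dart_edge D x = dart_edge D y)}"

definition faces :: "link_diagram \<Rightarrow> (nat \<times> nat) set set" where
  "faces D = gen_classes (darts D)
     {(x, (c, Suc p mod 4)) | x c p. x \<in> darts D \<and> (c, p) \<in> darts D \<and> x \<noteq> (c, p)
        \<and> dart_edge D x = dart_edge D (c, p)}"

text \<open>
  Planarity is Euler's formula: with \<open>n\<close> vertices and \<open>2 n\<close> edges, the Euler characteristic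
  \<open>n - 2 n + F\<close> of the closed surface carrying the graph is twice the number of components exactly
  when every component of the surface is a sphere.
\<close>

definition planar :: "link_diagram \<Rightarrow> bool" where
  "planar D \<longleftrightarrow> card (faces D) = ncross D + 2 * card (graph_components D)"

text \<open>
  Every edge that meets a crossing starts at exactly one (outgoing) dart and ends at exactly one
  (incoming) dart.
\<close>

definition oriented_link_diagram :: "link_diagram \<Rightarrow> bool" where
  "oriented_link_diagram D \<longleftrightarrow>
     finite (edges D) \<and>
     dart_edge D ` darts D \<subseteq> edges D \<and>
     inj_on (dart_edge D) (in_darts D) \<and>
     inj_on (dart_edge D) (out_darts D) \<and>
     dart_edge D ` in_darts D = dart_edge D ` out_darts D \<and>
     planar D"


text \<open>A state is the set of its 1-smoothed crossings.\<close>

definition states :: "link_diagram \<Rightarrow> nat set set" where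
  "states D = Pow {..<ncross D}"

text \<open>
  With the edges listed as above, the 0-smoothing joins \<open>i, j\<close> and \<open>k, l\<close>, the 1-smoothing joins
  \<open>i, l\<close> and \<open>j, k\<close>; the former is the orientation-consistent one at \<open>Xp\<close>, the latter at \<open>Xm\<close>.
\<close>

definition smoothing_arcs :: "link_diagram \<Rightarrow> nat set \<Rightarrow> nat \<Rightarrow> (nat \<times> nat) set" where
  "smoothing_arcs D \<sigma> c =
     (if c \<in> \<sigma> then {(dart_edge D (c, 0), dart_edge D (c, 3)), (dart_edge D (c, 1), dart_edge D (c, 2))}
      else {(dart_edge D (c, 0), dart_edge D (c, 1)), (dart_edge D (c, 2), dart_edge D (c, 3))})"

text \<open>A loop is represented by the set of edges it runs through.\<close>

definition loop_of :: "link_diagram \<Rightarrow> nat set \<Rightarrow> nat \<Rightarrow> nat set" where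
  "loop_of D \<sigma> = gen_class (\<Union>c<ncross D. smoothing_arcs D \<sigma> c)"

definition loops :: "link_diagram \<Rightarrow> nat set \<Rightarrow> nat set set" where
  "loops D \<sigma> = gen_classes (edges D) (\<Union>c<ncross D. smoothing_arcs D \<sigma> c)"

text \<open>
  The trace at \<open>c\<close> joins the two strands of the smoothing at \<open>c\<close>; in either smoothing, one of them
  contains the end of edge \<open>(c, 0)\<close> and the other the end of edge \<open>(c, 2)\<close>.
\<close>

definition strand1 :: "link_diagram \<Rightarrow> nat set \<Rightarrow> nat \<Rightarrow> nat set" where
  "strand1 D \<sigma> c = loop_of D \<sigma> (dart_edge D (c, 0))"

definition strand2 :: "link_diagram \<Rightarrow> nat set \<Rightarrow> nat \<Rightarrow> nat set" where
  "strand2 D \<sigma> c = loop_of D \<sigma> (dart_edge D (c, 2))"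

definition traces0 :: "link_diagram \<Rightarrow> nat set \<Rightarrow> nat set" where
  "traces0 D \<sigma> = {..<ncross D} - \<sigma>"

definition traces1 :: "link_diagram \<Rightarrow> nat set \<Rightarrow> nat set" where
  "traces1 D \<sigma> = {..<ncross D} \<inter> \<sigma>"

definition trace_loops :: "link_diagram \<Rightarrow> nat set \<Rightarrow> nat \<Rightarrow> nat set set" where
  "trace_loops D \<sigma> c = {strand1 D \<sigma> c, strand2 D \<sigma> c}"

definition mergetrace :: "link_diagram \<Rightarrow> nat set \<Rightarrow> nat \<Rightarrow> bool" where
  "mergetrace D \<sigma> c \<longleftrightarrow> strand1 D \<sigma> c \<noteq> strand2 D \<sigma> c"

definition pinchtrace :: "link_diagram \<Rightarrow> nat set \<Rightarrow> nat \<Rightarrow> bool" where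
  "pinchtrace D \<sigma> c \<longleftrightarrow> strand1 D \<sigma> c = strand2 D \<sigma> c"

definition zero_merging :: "link_diagram \<Rightarrow> nat set \<Rightarrow> bool" where
  "zero_merging D \<sigma> \<longleftrightarrow> (\<forall>c\<in>traces0 D \<sigma>. mergetrace D \<sigma> c)"

definition zero_tracing :: "link_diagram \<Rightarrow> nat set \<Rightarrow> nat set \<Rightarrow> bool" where
  "zero_tracing D \<sigma> L \<longleftrightarrow> (\<exists>c\<in>traces0 D \<sigma>. L \<in> trace_loops D \<sigma> c)"

definition one_tracing :: "link_diagram \<Rightarrow> nat set \<Rightarrow> nat set \<Rightarrow> bool" where
  "one_tracing D \<sigma> L \<longleftrightarrow> (\<exists>c\<in>traces1 D \<sigma>. L \<in> trace_loops D \<sigma> c)"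

definition one_block :: "link_diagram \<Rightarrow> nat set \<Rightarrow> nat set set" where
  "one_block D \<sigma> = {L \<in> loops D \<sigma>. one_tracing D \<sigma> L \<and> \<not> zero_tracing D \<sigma> L}"

text \<open>
  The 1-block graph is a multigraph: its vertices are the loops of the 1-block, its edges are the
  1-traces with both ends on such loops, so there may be parallel edges, and a 1-pinchtrace gives
  a graph loop.
\<close>

definition one_block_adj :: "link_diagram \<Rightarrow> nat set \<Rightarrow> (nat set \<times> nat set) set" where
  "one_block_adj D \<sigma> =
     {(A, B). A \<in> one_block D \<sigma> \<and> B \<in> one_block D \<sigma>
        \<and> (\<exists>c\<in>traces1 D \<sigma>. trace_loops D \<sigma> c = {A, B})}"

definition one_block_components :: "link_diagram \<Rightarrow> nat set \<Rightarrow> nat set set set" where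
  "one_block_components D \<sigma> = gen_classes (one_block D \<sigma>) (one_block_adj D \<sigma>)"

text \<open>A circuit is a nonempty closed trail, with vertices \<open>Ls\<close> and pairwise distinct edges \<open>cs\<close>.\<close>

definition circuit_in ::
    "link_diagram \<Rightarrow> nat set \<Rightarrow> nat set set \<Rightarrow> nat set list \<Rightarrow> nat list \<Rightarrow> bool" where
  "circuit_in D \<sigma> K Ls cs \<longleftrightarrow>
     cs \<noteq> [] \<and> length Ls = Suc (length cs) \<and> hd Ls = last Ls \<and>
     set Ls \<subseteq> K \<and> set cs \<subseteq> traces1 D \<sigma> \<and> distinct cs \<and>
     (\<forall>t<length cs. trace_loops D \<sigma> (cs ! t) = {Ls ! t, Ls ! Suc t})"

definition even_component :: "link_diagram \<Rightarrow> nat set \<Rightarrow> nat set set \<Rightarrow> bool" where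
  "even_component D \<sigma> K \<longleftrightarrow> (\<forall>Ls cs. circuit_in D \<sigma> K Ls cs \<longrightarrow> even (length cs))"

definition odd_component :: "link_diagram \<Rightarrow> nat set \<Rightarrow> nat set set \<Rightarrow> bool" where
  "odd_component D \<sigma> K \<longleftrightarrow> \<not> even_component D \<sigma> K"


datatype mark = Vplus | Vminus

type_synonym marking = "nat set \<Rightarrow> mark"

type_synonym estate = "nat set \<times> marking"

type_synonym chain = "estate \<Rightarrow> rat"

text \<open>Markings are \<open>undefined\<close> outside the set of loops, so that they are determined by the loops.\<close>

definition markings :: "link_diagram \<Rightarrow> nat set \<Rightarrow> marking set" where
  "markings D \<sigma> = {m. \<forall>L. L \<notin> loops D \<sigma> \<longrightarrow> m L = undefined}"

definition enhanced_states :: "link_diagram \<Rightarrow> estate set" where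
  "enhanced_states D = Sigma (states D) (markings D)"

text \<open>The value of the merging map on a basis element; \<open>None\<close> stands for \<open>0\<close>.\<close>

fun merge_map :: "mark \<Rightarrow> mark \<Rightarrow> mark option" where
  "merge_map Vplus Vplus = Some Vplus"
| "merge_map Vplus Vminus = Some Vminus"
| "merge_map Vminus Vplus = Some Vminus"
| "merge_map Vminus Vminus = None"

text \<open>The set of basis elements whose sum is the value of the splitting map.\<close>

fun split_map :: "mark \<Rightarrow> (mark \<times> mark) set" where
  "split_map Vplus = {(Vplus, Vminus), (Vminus, Vplus)}"
| "split_map Vminus = {(Vminus, Vminus)}"

text \<open>
  The coefficient of \<open>(insert c \<sigma>, m')\<close> in the value of \<open>d\<^sub>e\<close> at \<open>(\<sigma>, m)\<close>, where \<open>e\<close> is the edge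
  of the cube that changes the smoothing at \<open>c\<close>.  The loops common to both states are the
  unaffected ones: an affected loop changes its set of edges because, by planarity, either two
  loops merge or one loop splits.
\<close>

definition edge_coeff :: "link_diagram \<Rightarrow> nat \<Rightarrow> nat set \<Rightarrow> marking \<Rightarrow> marking \<Rightarrow> rat" where
  "edge_coeff D c \<sigma> m m' =
     (let \<tau> = insert c \<sigma> in
      if \<forall>L \<in> loops D \<sigma> \<inter> loops D \<tau>. m' L = m L
      then if mergetrace D \<sigma> c
        then of_bool (merge_map (m (strand1 D \<sigma> c)) (m (strand2 D \<sigma> c)) = Some (m' (strand1 D \<tau> c)))
        else of_bool ((m' (strand1 D \<tau> c), m' (strand2 D \<tau> c)) \<in> split_map (m (strand1 D \<sigma> c)))
      else 0)"

definition diff_coeff :: "link_diagram \<Rightarrow> estate \<Rightarrow> estate \<Rightarrow> rat" where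
  "diff_coeff D = (\<lambda>(\<sigma>, m) (\<tau>, m').
     \<Sum>c \<in> traces0 D \<sigma>.
       if \<tau> = insert c \<sigma> then (-1) ^ card {b \<in> \<sigma>. b < c} * edge_coeff D c \<sigma> m m' else 0)"

definition chains :: "link_diagram \<Rightarrow> chain set" where
  "chains D = {x. \<forall>s. s \<notin> enhanced_states D \<longrightarrow> x s = 0}"

definition basis_chain :: "estate \<Rightarrow> chain" where
  "basis_chain s = (\<lambda>t. of_bool (t = s))"

definition differential :: "link_diagram \<Rightarrow> chain \<Rightarrow> chain" where
  "differential D x =
     (\<lambda>t. if t \<in> enhanced_states D then \<Sum>s\<in>enhanced_states D. x s * diff_coeff D s t else 0)"

definition boundaries :: "link_diagram \<Rightarrow> chain set" where
  "boundaries D = differential D ` chains D"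

text \<open>
  The class of a cycle in the total homology, the direct sum of the homology groups in the various
  degrees.  The degree shifts by the numbers of positive and negative crossings play no role.
\<close>

definition homology_class :: "link_diagram \<Rightarrow> chain \<Rightarrow> chain set" where
  "homology_class D z = {z + y | y. y \<in> boundaries D}"

definition state_cycle :: "link_diagram \<Rightarrow> estate \<Rightarrow> bool" where
  "state_cycle D \<alpha> \<longleftrightarrow> \<alpha> \<in> enhanced_states D \<and> differential D (basis_chain \<alpha>) = 0"

definition nontrivial :: "link_diagram \<Rightarrow> estate \<Rightarrow> bool" where
  "nontrivial D \<alpha> \<longleftrightarrow> homology_class D (basis_chain \<alpha>) \<noteq> homology_class D 0"


definition joined_by_only_1_traces :: "link_diagram \<Rightarrow> nat set \<Rightarrow> nat set \<Rightarrow> nat set \<Rightarrow> bool" where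
  "joined_by_only_1_traces D \<sigma> A B \<longleftrightarrow>
     (\<exists>c<ncross D. trace_loops D \<sigma> c = {A, B}) \<and>
     (\<forall>c<ncross D. trace_loops D \<sigma> c = {A, B} \<longrightarrow> c \<in> traces1 D \<sigma>)"

definition no_minus_pair_joined_by_only_1_traces :: "link_diagram \<Rightarrow> nat set \<Rightarrow> marking \<Rightarrow> bool" where
  "no_minus_pair_joined_by_only_1_traces D \<sigma> m \<longleftrightarrow>
     \<not> (\<exists>A\<in>loops D \<sigma>. \<exists>B\<in>loops D \<sigma>. A \<noteq> B \<and> m A = Vminus \<and> m B = Vminus
          \<and> joined_by_only_1_traces D \<sigma> A B)"

definition only_minus_in :: "nat set set \<Rightarrow> marking \<Rightarrow> nat set \<Rightarrow> bool" where
  "only_minus_in K m L \<longleftrightarrow> L \<in> K \<and> m L = Vminus \<and> (\<forall>L'\<in>K - {L}. m L' = Vplus)"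

end

theory Submission
  imports Defs "HOL-Combinatorics.Orbits"
begin

text \<open>
  Every part of the nontriviality statement is proved by exhibiting an explicit primitive.
  Coefficients of \<open>d\<close> at different crossings land in different states, so they cannot cancel: an
  enhanced state is a cycle exactly when each of its 0-traces joins two distinct loops, both marked
  \<open>v\<^sub>-\<close> (\<open>state_cycle_iff\<close>). This gives the two conditions on 0-traces at once.

  For the conditions on 1-traces, one changes a 1-smoothing at a crossing \<open>c\<close> back to a 0-smoothing
  and marks the resulting state so that all edges of the cube other than the one at \<open>c\<close> still meet
  two loops marked \<open>v\<^sub>-\<close> and contribute \<open>0\<close>. The differential of that enhanced state is then, up to
  sign, just the value of \<open>d\<^sub>e\<close> at \<open>c\<close> (\<open>edge_image_in_boundaries\<close>). A 1-pinchtrace on a loop without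
  0-traces comes from merging a \<open>v\<^sub>+\<close> into that loop (\<open>one_pinchtrace_boundary\<close>); two \<open>v\<^sub>-\<close> joined only
  by 1-traces are the split of one \<open>v\<^sub>-\<close> (\<open>minus_pair_boundary\<close>); and the split of a \<open>v\<^sub>+\<close> shows that
  moving a \<open>v\<^sub>-\<close> along an edge of the 1-block graph changes only the sign of the homology class
  (\<open>move_minus_boundary\<close>). Hence two \<open>v\<^sub>-\<close> in one component can be moved until they are adjacent and
  then vanish, while moving a single \<open>v\<^sub>-\<close> around a circuit of odd length gives \<open>[\<alpha>] = -[\<alpha>]\<close>, which
  forces \<open>[\<alpha>] = 0\<close> over the rationals. Moving it along a path gives the last assertion.

  All this needs that changing one smoothing either merges two loops or splits one, never turns one
  loop into one loop; this is where planarity enters. Euler's formula makes the first cohomology of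
  the surface with coefficients in the field of two elements vanish, and this produces an orientation
  of all edges that alternates between inward and outward around each crossing
  (\<open>alternating_orientation\<close>). Such an orientation is respected by both smoothings of every crossing,
  so the loops of a state are the orbits of a permutation of the edges, and changing one smoothing
  composes this permutation with a transposition, which merges two orbits or splits one
  (\<open>loop_of_toggle_merge\<close>, \<open>toggle_pinch\<close>).
\<close>

section \<open>Generated equivalence classes\<close>
lemma gen_class_refl: "a \<in> gen_class R a"
  by (simp add: gen_class_def)

lemma gen_class_step: "(b, c) \<in> R \<or> (c, b) \<in> R \<Longrightarrow> b \<in> gen_class R a \<Longrightarrow> c \<in> gen_class R a"
  unfolding gen_class_def by (auto intro: rtrancl_into_rtrancl)

lemma gen_class_eq: assumes "b \<in> gen_class R a" shows "gen_class R b = gen_class R a"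
proof -
  have ab: "(a, b) \<in> (R \<union> R\<inverse>)\<^sup>*" using assms by (simp add: gen_class_def)
  have "sym ((R \<union> R\<inverse>)\<^sup>*)" by (intro sym_rtrancl) (auto simp: sym_def)
  then have "(b, a) \<in> (R \<union> R\<inverse>)\<^sup>*" using ab by (auto dest: symD)
  with ab show ?thesis unfolding gen_class_def by (auto intro: rtrancl_trans)
qed

lemma gen_class_closed_subset:
  assumes "a \<in> U" and "\<And>x y. (x, y) \<in> R \<Longrightarrow> x \<in> U \<longleftrightarrow> y \<in> U"
  shows "gen_class R a \<subseteq> U"
proof
  fix b assume "b \<in> gen_class R a"
  then have "(a, b) \<in> (R \<union> R\<inverse>)\<^sup>*" by (simp add: gen_class_def)
  then show "b \<in> U" by induction (use assms in auto)
qed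

section \<open>Counting in vector spaces over the field with two elements\<close>

text \<open>
  Subsets of a finite set are vectors over the field with two elements: the sum is the symmetric
  difference, and the inner product is the parity of the size of the intersection.
\<close>
lemma parity_card_sym_diff:
  assumes "finite A" "finite B"
  shows "even (card (sym_diff A B)) \<longleftrightarrow> (even (card A) \<longleftrightarrow> even (card B))"
proof -
  have "card (sym_diff A B) = card (A - B) + card (B - A)"
    using assms by (intro card_Un_disjoint) auto
  moreover have "card A = card (A - B) + card (A \<inter> B)" "card B = card (B - A) + card (A \<inter> B)"
    using assms by (simp_all add: card_Diff_subset_Int Int_commute card_mono)
  ultimately show ?thesis by simp presburger
qed

text \<open>
  Adding or removing a fixed element of \<open>c\<close> flips the sign of every term.
\<close>
lemma sum_characters:
  assumes fin: "finite E" and cE: "c \<subseteq> E"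
  shows "(\<Sum>z\<in>Pow E. (-1) ^ card (c \<inter> z) :: int) = (if c = {} then 2 ^ card E else 0)"
proof (cases "c = {}")
  case True then show ?thesis using fin by (simp add: card_Pow)
next
  case False
  then obtain a where a: "a \<in> c" by blast
  let ?t = "\<lambda>z. sym_diff z {a}"
  have flip: "(-1::int) ^ card (c \<inter> ?t z) = - ((-1) ^ card (c \<inter> z))" if "z \<in> Pow E" for z
  proof -
    have "c \<inter> ?t z = sym_diff (c \<inter> z) {a}" using a by auto
    moreover have "finite (c \<inter> z)" using fin cE finite_subset by blast
    ultimately have "even (card (c \<inter> ?t z)) \<longleftrightarrow> odd (card (c \<inter> z))"
      using parity_card_sym_diff[of "c \<inter> z" "{a}"] by simp
    then show ?thesis by (auto simp: minus_one_power_iff)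
  qed
  have "(\<Sum>z\<in>Pow E. (-1::int) ^ card (c \<inter> z)) = (\<Sum>z\<in>Pow E. (-1) ^ card (c \<inter> ?t z))"
  proof (rule sum.reindex_bij_witness[of _ ?t ?t])
    show inv: "?t (?t z) = z" for z by auto
    show inv': "?t (?t z) = z" for z by (rule inv)
    show "(-1::int) ^ card (c \<inter> ?t (?t z)) = (-1) ^ card (c \<inter> z)" for z by (simp only: inv)
  qed (use a cE in auto)
  also have "\<dots> = - (\<Sum>z\<in>Pow E. (-1) ^ card (c \<inter> z))"
    using flip by (simp add: sum_negf)
  finally show ?thesis using False by simp
qed

text \<open>
  The dimensions of a subspace and of its annihilator add up to the dimension of the space. Evaluate
  the sum of \<open>(-1) ^ card (c \<inter> z)\<close> over all \<open>c \<in> C\<close> and all \<open>z\<close> in both orders: summing over \<open>z\<close> first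
  leaves only \<open>c = {}\<close>; summing over \<open>c\<close> first leaves only the \<open>z\<close> in the annihilator.
\<close>
lemma card_annihilator:
  assumes fin: "finite E" and CE: "C \<subseteq> Pow E" and C0: "{} \<in> C"
    and Cd: "\<And>a b. a \<in> C \<Longrightarrow> b \<in> C \<Longrightarrow> sym_diff a b \<in> C"
  shows "card C * card {z \<in> Pow E. \<forall>c\<in>C. even (card (c \<inter> z))} = 2 ^ card E"
proof -
  let ?Z = "{z \<in> Pow E. \<forall>c\<in>C. even (card (c \<inter> z))}"
  have finC: "finite C" using CE fin finite_subset by blast
  have inner: "(\<Sum>c\<in>C. (-1::int) ^ card (c \<inter> z)) = (if z \<in> ?Z then int (card C) else 0)"
    if z: "z \<in> Pow E" for z
  proof (cases "z \<in> ?Z")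
    case True
    then have "(\<Sum>c\<in>C. (-1::int) ^ card (c \<inter> z)) = (\<Sum>c\<in>C. 1)"
      by (intro sum.cong) auto
    then show ?thesis using True by simp
  next
    case False
    then obtain c0 where c0: "c0 \<in> C" "odd (card (c0 \<inter> z))" using z by blast
    \<comment> \<open>Adding \<open>c0\<close> is an involution of \<open>C\<close> that flips all signs.\<close>
    let ?t = "\<lambda>c. sym_diff c c0"
    have flip: "(-1::int) ^ card (?t c \<inter> z) = - ((-1) ^ card (c \<inter> z))" if "c \<in> C" for c
    proof -
      have "?t c \<inter> z = sym_diff (c \<inter> z) (c0 \<inter> z)" by auto
      moreover have "finite (c \<inter> z)" "finite (c0 \<inter> z)" using fin z finite_subset by blast+
      ultimately have "even (card (?t c \<inter> z)) \<longleftrightarrow> odd (card (c \<inter> z))"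
        using parity_card_sym_diff[of "c \<inter> z" "c0 \<inter> z"] c0 by simp
      then show ?thesis by (auto simp: minus_one_power_iff)
    qed
    have "(\<Sum>c\<in>C. (-1::int) ^ card (c \<inter> z)) = (\<Sum>c\<in>C. (-1) ^ card (?t c \<inter> z))"
    proof (rule sum.reindex_bij_witness[of _ ?t ?t])
    show inv: "?t (?t c) = c" for c by auto
    show inv': "?t (?t c) = c" for c by (rule inv)
    show "(-1::int) ^ card (?t (?t c) \<inter> z) = (-1) ^ card (c \<inter> z)" for c by (simp only: inv)
  qed (use c0 Cd in auto)
    also have "\<dots> = - (\<Sum>c\<in>C. (-1) ^ card (c \<inter> z))"
      using flip by (simp add: sum_negf)
    finally show ?thesis using False by auto
  qed
  have "(\<Sum>c\<in>C. \<Sum>z\<in>Pow E. (-1::int) ^ card (c \<inter> z)) = (\<Sum>c\<in>C. if c = {} then 2 ^ card E else 0)"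
    by (intro sum.cong refl sum_characters[OF fin]) (use CE in auto)
  then have "2 ^ card E = (\<Sum>z\<in>Pow E. \<Sum>c\<in>C. (-1::int) ^ card (c \<inter> z))"
    using C0 finC by (simp add: sum.swap[of _ C])
  also have "\<dots> = (\<Sum>z\<in>Pow E. if z \<in> ?Z then int (card C) else 0)"
    by (intro sum.cong refl inner)
  also have "\<dots> = (\<Sum>z\<in>Pow E \<inter> ?Z. int (card C))"
    by (rule sum.inter_restrict[symmetric]) (use fin in simp)
  also have "Pow E \<inter> ?Z = ?Z" by auto
  finally have "int (card C * card ?Z) = int (2 ^ card E)" by simp
  then show ?thesis by (simp only: of_nat_eq_iff)
qed

text \<open>
  A coset of the kernel is carried into the kernel by subtracting one of its elements.
\<close>
lemma card_le_image_times_kernel: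
  assumes fin: "finite G" and Gd: "\<And>a b. a \<in> G \<Longrightarrow> b \<in> G \<Longrightarrow> sym_diff a b \<in> G"
    and add: "\<And>a b. a \<in> G \<Longrightarrow> b \<in> G \<Longrightarrow> f (sym_diff a b) = sym_diff (f a) (f b)"
  shows "card G \<le> card (f ` G) * card {a \<in> G. f a = {}}"
proof -
  have "card G = (\<Sum>y\<in>f ` G. card {a \<in> G. f a = y})"
    using card_eq_sum[of G] sum.image_gen[OF fin, of "\<lambda>_. 1::nat" f] by simp
  also have "\<dots> \<le> (\<Sum>y\<in>f ` G. card {a \<in> G. f a = {}})"
  proof (rule sum_mono)
    fix y assume "y \<in> f ` G"
    then obtain b where b: "b \<in> G" "y = f b" by blast
    show "card {a \<in> G. f a = y} \<le> card {a \<in> G. f a = {}}"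
    proof (rule card_inj_on_le[where f = "\<lambda>a. sym_diff a b"])
      show "inj_on (\<lambda>a. sym_diff a b) {a \<in> G. f a = y}"
        by (rule inj_on_inverseI[where g = "\<lambda>a. sym_diff a b"]) auto
    qed (use b Gd add fin in auto)
  qed
  finally show ?thesis by simp
qed

section \<open>An alternating orientation of a planar diagram\<close>
locale diagram =
  fixes D :: link_diagram
  assumes oriented: "oriented_link_diagram D"
begin

abbreviation "n \<equiv> ncross D"
abbreviation "X \<equiv> darts D"
abbreviation "e \<equiv> dart_edge D"

lemma finite_darts: "finite X" by (simp add: darts_def)

lemma opposite_dart_unique: "x \<in> X \<Longrightarrow> \<exists>!y. y \<in> X \<and> y \<noteq> x \<and> e y = e x"
proof -
  assume x: "x \<in> X"
  have inj: "inj_on e (in_darts D)" "inj_on e (out_darts D)" "e ` in_darts D = e ` out_darts D"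
    using oriented by (auto simp: oriented_link_diagram_def)
  have un: "X = in_darts D \<union> out_darts D" "in_darts D \<inter> out_darts D = {}"
    by (auto simp: in_darts_def out_darts_def)
  \<comment> \<open>The opposite dart of an incoming dart is outgoing, and conversely; the two cases are symmetric.\<close>
  have key: "\<exists>!y. y \<in> X \<and> y \<noteq> x \<and> e y = e x"
    if AB: "X = A \<union> B" "A \<inter> B = {}" "inj_on e A" "inj_on e B" "e ` A = e ` B" and xA: "x \<in> A" for A B
  proof -
    have "e x \<in> e ` B" using xA AB(5) by blast
    then obtain y where y: "y \<in> B" "e y = e x" by (metis imageE)
    show ?thesis
    proof (rule ex1I[of _ y])
      show "y \<in> X \<and> y \<noteq> x \<and> e y = e x" using y xA AB(1,2) by auto
      fix w assume w: "w \<in> X \<and> w \<noteq> x \<and> e w = e x"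
      then have "w \<notin> A" using inj_onD[OF AB(3), of w x] xA by auto
      then have "w \<in> B" using w AB(1) by auto
      then show "w = y" using inj_onD[OF AB(4), of w y] w y by auto
    qed
  qed
  show ?thesis using key[of "in_darts D" "out_darts D"] key[of "out_darts D" "in_darts D"] un inj x
    by (metis Int_commute Un_commute Un_iff)
qed

definition opp :: "nat \<times> nat \<Rightarrow> nat \<times> nat" where
  "opp x = (THE y. y \<in> X \<and> y \<noteq> x \<and> e y = e x)"

lemma opp: "x \<in> X \<Longrightarrow> opp x \<in> X" "x \<in> X \<Longrightarrow> opp x \<noteq> x" "x \<in> X \<Longrightarrow> e (opp x) = e x"
  using theI'[OF opposite_dart_unique[of x]] unfolding opp_def by auto

lemma opp_eqI: "x \<in> X \<Longrightarrow> y \<in> X \<Longrightarrow> y \<noteq> x \<Longrightarrow> e y = e x \<Longrightarrow> y = opp x"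
  using opposite_dart_unique[of x] opp[of x] by auto

lemma opp_opp: "x \<in> X \<Longrightarrow> opp (opp x) = x"
  using opp_eqI[of "opp x" x] opp[of x] by auto

lemma edge_eq_iff: "x \<in> X \<Longrightarrow> y \<in> X \<Longrightarrow> e x = e y \<longleftrightarrow> y = x \<or> y = opp x"
  using opp_eqI[of x y] opp[of x] by metis

definition rot :: "nat \<times> nat \<Rightarrow> nat \<times> nat" where
  "rot x = (fst x, Suc (snd x) mod 4)"

lemma rot: "x \<in> X \<Longrightarrow> rot x \<in> X" by (auto simp: rot_def darts_def)

definition face_step :: "nat \<times> nat \<Rightarrow> nat \<times> nat" where
  "face_step x = rot (opp x)"

lemma face_step: "x \<in> X \<Longrightarrow> face_step x \<in> X" by (simp add: face_step_def opp rot)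

lemma inj_on_face_step: "inj_on face_step X"
proof (rule inj_onI)
  fix x y assume xy: "x \<in> X" "y \<in> X" "face_step x = face_step y"
  have "snd (opp x) < 4" "snd (opp y) < 4" using opp(1) xy by (force simp: darts_def)+
  moreover have "Suc (snd (opp x)) mod 4 = Suc (snd (opp y)) mod 4" "fst (opp x) = fst (opp y)"
    using xy by (auto simp: face_step_def rot_def)
  ultimately have "opp x = opp y"
    by (auto simp: prod_eq_iff mod_Suc split: if_splits)
  then show "x = y" using opp_opp xy by metis
qed

text \<open>
  Sets of vertices and sets of faces are both represented by sets of darts: those starting at one of
  the vertices, or lying on the boundary walk of one of the faces. The edges with exactly one dart in
  such a set are the coboundary of the set of vertices, and the boundary of the set of faces,
  respectively, so that one operation \<open>coboundary\<close> serves both.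
\<close>
definition vertex_sets where
  "vertex_sets = {U. U \<subseteq> X \<and> (\<forall>x\<in>X. \<forall>y\<in>X. fst x = fst y \<longrightarrow> (x \<in> U \<longleftrightarrow> y \<in> U))}"

lemma vertex_setsD:
  "U \<in> vertex_sets \<Longrightarrow> x \<in> X \<Longrightarrow> y \<in> X \<Longrightarrow> fst x = fst y \<Longrightarrow> x \<in> U \<longleftrightarrow> y \<in> U"
  unfolding vertex_sets_def by blast

definition face_sets where
  "face_sets = {U. U \<subseteq> X \<and> (\<forall>x\<in>X. x \<in> U \<longleftrightarrow> face_step x \<in> U)}"

definition coboundary where
  "coboundary U = {e x | x. x \<in> U \<and> opp x \<notin> U}"

lemma mem_coboundary: assumes "U \<subseteq> X" "x \<in> X" shows "e x \<in> coboundary U \<longleftrightarrow> (x \<in> U) \<noteq> (opp x \<in> U)"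
proof -
  have "e x \<in> coboundary U \<longleftrightarrow> (\<exists>y\<in>U. opp y \<notin> U \<and> e x = e y)" unfolding coboundary_def by blast
  also have "\<dots> \<longleftrightarrow> (x \<in> U \<and> opp x \<notin> U) \<or> (opp x \<in> U \<and> x \<notin> U)"
    using assms edge_eq_iff[of x] opp_opp opp by (metis subsetD)
  finally show ?thesis by blast
qed

lemma coboundary_subset: "U \<subseteq> X \<Longrightarrow> coboundary U \<subseteq> e ` X"
  unfolding coboundary_def by blast

lemma edge_sets_eqI:
  assumes "P \<subseteq> e ` X" "Q \<subseteq> e ` X" "\<And>x. x \<in> X \<Longrightarrow> e x \<in> P \<longleftrightarrow> e x \<in> Q"
  shows "P = Q"
proof (rule set_eqI)
  fix a show "a \<in> P \<longleftrightarrow> a \<in> Q"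
  proof (cases "a \<in> e ` X")
    case True then show ?thesis using assms(3) by (elim imageE) simp
  next
    case False then show ?thesis using assms(1,2) by (meson subsetD)
  qed
qed

lemma coboundary_sym_diff:
  assumes "U \<subseteq> X" "W \<subseteq> X" shows "coboundary (sym_diff U W) = sym_diff (coboundary U) (coboundary W)"
proof (rule edge_sets_eqI)
  show "coboundary (sym_diff U W) \<subseteq> e ` X" using assms by (intro coboundary_subset) auto
  show "sym_diff (coboundary U) (coboundary W) \<subseteq> e ` X" using assms coboundary_subset by blast
  fix x assume x: "x \<in> X"
  have "sym_diff U W \<subseteq> X" using assms by auto
  then show "e x \<in> coboundary (sym_diff U W) \<longleftrightarrow> e x \<in> sym_diff (coboundary U) (coboundary W)"
    by (simp only: mem_coboundary[OF _ x] assms Un_iff Diff_iff) argo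
qed

lemma card_edges: "card (e ` X) = 2 * n"
proof -
  have inj: "inj_on e (in_darts D)" "e ` in_darts D = e ` out_darts D"
    using oriented by (auto simp: oriented_link_diagram_def)
  have un: "X = in_darts D \<union> out_darts D"
    by (auto simp: in_darts_def out_darts_def)
  have "e ` X = e ` in_darts D" by (simp only: un image_Un inj(2)[symmetric] Un_absorb)
  then have "card (e ` X) = card (in_darts D)" using inj(1) by (simp add: card_image)
  also have "in_darts D = Sigma {..<n} (\<lambda>c. incoming (crossings D ! c))"
  proof -
    have "incoming k \<subseteq> {..<4}" for k by (cases k) auto
    then show ?thesis by (auto simp: in_darts_def darts_def)
  qed
  also have "card \<dots> = (\<Sum>c<n. card (incoming (crossings D ! c)))"
  proof -
    have "finite (incoming k)" for k by (cases k) auto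
    then show ?thesis by simp
  qed
  also have "\<dots> = (\<Sum>c<n. 2)"
  proof (intro sum.cong refl)
    fix c show "card (incoming (crossings D ! c)) = 2" by (cases "crossings D ! c") auto
  qed
  finally show ?thesis by simp
qed

lemma even_card_opp_closed:
  assumes "A \<subseteq> X" "\<And>x. x \<in> A \<Longrightarrow> opp x \<in> A" shows "even (card A)"
proof -
  have inn: "in_darts D \<subseteq> X" by (auto simp: in_darts_def)
  have inj: "inj_on e (in_darts D)" "inj_on e (out_darts D)"
    using oriented by (auto simp: oriented_link_diagram_def)
  have flip: "opp x \<in> in_darts D \<longleftrightarrow> x \<notin> in_darts D" if "x \<in> X" for x
    using opp[OF that] inj that by (auto simp: out_darts_def inj_on_def)
  have fin: "finite A" using assms finite_darts finite_subset by blast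
  have "bij_betw opp (A \<inter> in_darts D) (A - in_darts D)"
    by (rule bij_betw_byWitness[where f' = opp]) (use assms opp_opp flip in auto)
  then have "card (A \<inter> in_darts D) = card (A - in_darts D)" by (rule bij_betw_same_card)
  moreover have "card A = card (A \<inter> in_darts D) + card (A - in_darts D)"
    using fin by (metis card_Diff_subset_Int card_Int_Diff finite_Int)
  ultimately show ?thesis by simp
qed

text \<open>
  Going once around the faces in \<open>U\<close>, the truth value of \<open>g\<close> changes an even number of times. The edges
  with both darts in \<open>U\<close> are passed twice, so an even number of changes remains on the coboundary.
  This is the orthogonality of face boundaries and cocycles.
\<close>
lemma even_coboundary_Int:
  fixes g :: "nat \<times> nat \<Rightarrow> bool"
  assumes U: "U \<in> face_sets" and z: "z \<subseteq> e ` X"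
    and g: "\<And>x. x \<in> X \<Longrightarrow> e x \<in> z \<longleftrightarrow> g x \<noteq> g (face_step x)"
  shows "even (card (coboundary U \<inter> z))"
proof -
  have UX: "U \<subseteq> X" and Uf: "\<And>x. x \<in> X \<Longrightarrow> x \<in> U \<longleftrightarrow> face_step x \<in> U"
    using U by (auto simp: face_sets_def)
  have fin: "finite U" using UX finite_darts finite_subset by blast
  let ?O = "{x \<in> U. opp x \<notin> U \<and> e x \<in> z}" and ?I = "{x \<in> U. opp x \<in> U \<and> e x \<in> z}"
  have "inj_on e ?O" using UX by (intro inj_onI) (auto dest!: edge_eq_iff[THEN iffD1, rotated 2])
  moreover have "e ` ?O = coboundary U \<inter> z" by (auto simp: coboundary_def)
  ultimately have 1: "card (coboundary U \<inter> z) = card ?O" using card_image[of e ?O] by simp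
  have 2: "even (card ?I)" using UX opp opp_opp by (intro even_card_opp_closed) auto
  let ?G = "{x \<in> U. g x}" and ?H = "{x \<in> U. g (face_step x)}"
  have im: "face_step ` U = U"
    using fin Uf UX inj_on_subset[OF inj_on_face_step UX] by (intro endo_inj_surj) auto
  have "bij_betw face_step ?H ?G"
    unfolding bij_betw_def
  proof
    show "inj_on face_step ?H" using inj_on_face_step UX by (auto intro: inj_on_subset)
    show "face_step ` ?H = ?G"
    proof (intro set_eqI iffI)
      fix y assume "y \<in> ?G"
      then obtain x where "x \<in> U" "y = face_step x" using im by blast
      then show "y \<in> face_step ` ?H" using \<open>y \<in> ?G\<close> by blast
    qed (use im in blast)
  qed
  then have "card ?H = card ?G" by (rule bij_betw_same_card)
  then have "even (card (sym_diff ?G ?H))"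
    using parity_card_sym_diff[of ?G ?H] fin by simp
  moreover have "sym_diff ?G ?H = ?O \<union> ?I" using g UX by auto
  moreover have "card (?O \<union> ?I) = card ?O + card ?I" using fin by (intro card_Un_disjoint) auto
  ultimately show ?thesis using 1 2 by simp
qed

lemma sym_diff_sets:
  shows "U \<in> face_sets \<Longrightarrow> W \<in> face_sets \<Longrightarrow> sym_diff U W \<in> face_sets"
    and "U \<in> vertex_sets \<Longrightarrow> W \<in> vertex_sets \<Longrightarrow> sym_diff U W \<in> vertex_sets"
proof -
  assume UW: "U \<in> face_sets" "W \<in> face_sets"
  have "x \<in> sym_diff U W \<longleftrightarrow> face_step x \<in> sym_diff U W" if "x \<in> X" for x
    using UW that by (simp add: face_sets_def)
  then show "sym_diff U W \<in> face_sets" using UW unfolding face_sets_def by blast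
next
  assume UW: "U \<in> vertex_sets" "W \<in> vertex_sets"
  have "x \<in> sym_diff U W \<longleftrightarrow> y \<in> sym_diff U W" if "x \<in> X" "y \<in> X" "fst x = fst y" for x y
  proof -
    have "x \<in> U \<longleftrightarrow> y \<in> U" "x \<in> W \<longleftrightarrow> y \<in> W" using UW that unfolding vertex_sets_def by blast+
    then show ?thesis by simp
  qed
  then show "sym_diff U W \<in> vertex_sets" using UW unfolding vertex_sets_def by blast
qed

lemma finite_sets: "finite face_sets" "finite vertex_sets"
  by (rule finite_subset[of _ "Pow X"]; use finite_darts in \<open>auto simp: face_sets_def vertex_sets_def\<close>)+

lemma card_vertex_sets: "2 ^ n \<le> card vertex_sets"
proof -
  have "card (Pow {..<n}) \<le> card vertex_sets"
  proof (rule card_inj_on_le[where f = "\<lambda>T. {x \<in> X. fst x \<in> T}"])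
    show "inj_on (\<lambda>T. {x \<in> X. fst x \<in> T}) (Pow {..<n})"
    proof (rule inj_on_inverseI[where g = "\<lambda>U. fst ` U"])
      fix T assume "T \<in> Pow {..<n}"
      then have "c \<in> T \<Longrightarrow> (c, 0) \<in> {x \<in> X. fst x \<in> T}" for c by (auto simp: darts_def)
      then show "fst ` {x \<in> X. fst x \<in> T} = T" by force
    qed
  qed (use finite_sets in \<open>auto simp: vertex_sets_def\<close>)
  then show ?thesis by (simp add: card_Pow)
qed

definition face_rel where
  "face_rel = {(x, (c, Suc p mod 4)) | x c p. x \<in> X \<and> (c, p) \<in> X \<and> x \<noteq> (c, p) \<and> e x = e (c, p)}"

lemma face_rel: "(x, y) \<in> face_rel \<longleftrightarrow> x \<in> X \<and> y = face_step x"
proof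
  assume "(x, y) \<in> face_rel"
  then obtain c p where *: "x \<in> X" "(c, p) \<in> X" "x \<noteq> (c, p)" "e x = e (c, p)" "y = (c, Suc p mod 4)"
    unfolding face_rel_def by blast
  then have "(c, p) = opp x" using opp_eqI[of x "(c, p)"] by auto
  then show "x \<in> X \<and> y = face_step x" using * by (metis face_step_def rot_def fst_conv snd_conv)
next
  assume *: "x \<in> X \<and> y = face_step x"
  have "\<exists>c p. opp x = (c, p)" by fastforce
  then obtain c p where "opp x = (c, p)" by blast
  moreover from this have "y = (c, Suc p mod 4)" using * by (simp add: face_step_def rot_def)
  moreover have "(c, p) \<in> X" "x \<noteq> (c, p)" "e x = e (c, p)"
    using * opp[of x] calculation by auto
  ultimately show "(x, y) \<in> face_rel" using * unfolding face_rel_def by blast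
qed

lemma card_face_sets: "2 ^ card (faces D) \<le> card face_sets"
proof -
  have f: "faces D = gen_class face_rel ` X" by (simp add: faces_def gen_classes_def face_rel_def)
  have sub: "gen_class face_rel x \<subseteq> X" if "x \<in> X" for x
    by (rule gen_class_closed_subset[OF that]) (use face_step in \<open>auto simp: face_rel\<close>)
  have "card (Pow (faces D)) \<le> card face_sets"
  proof (rule card_inj_on_le[where f = Union])
    show "inj_on Union (Pow (faces D))"
    proof (rule inj_on_inverseI[where g = "\<lambda>U. gen_class face_rel ` U"])
      fix S assume S: "S \<in> Pow (faces D)"
      have *: "gen_class face_rel x = F" if "F \<in> S" "x \<in> F" for x F
        using that S gen_class_eq by (fastforce simp: f)
      moreover have "F \<noteq> {}" if "F \<in> S" for F using that S gen_class_refl by (fastforce simp: f)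
      ultimately show "gen_class face_rel ` \<Union> S = S" by (force simp: image_iff)
    qed
    show "Union ` Pow (faces D) \<subseteq> face_sets"
    proof
      fix U assume "U \<in> Union ` Pow (faces D)"
      then obtain S where S: "S \<subseteq> faces D" "U = \<Union> S" by auto
      have "x \<in> U \<longleftrightarrow> face_step x \<in> U" if "x \<in> X" for x
      proof -
        have "x \<in> F \<longleftrightarrow> face_step x \<in> F" if FS: "F \<in> S" for F
        proof -
          obtain a where F: "F = gen_class face_rel a" using FS S unfolding f by blast
          show ?thesis using \<open>x \<in> X\<close> unfolding F
            by (meson face_rel gen_class_step)
        qed
        then show ?thesis using S by auto
      qed
      moreover have "U \<subseteq> X" using S sub unfolding f by blast
      ultimately show "U \<in> face_sets" by (auto simp: face_sets_def)
    qed
  qed (rule finite_sets)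
  moreover have "finite (faces D)" unfolding f using finite_darts by simp
  ultimately show ?thesis by (simp add: card_Pow)
qed

definition component_sets where
  "component_sets = {U \<in> vertex_sets. \<forall>x\<in>X. x \<in> U \<longleftrightarrow> opp x \<in> U}"

lemma card_component_sets: "card component_sets \<le> 2 ^ card (graph_components D)"
proof -
  let ?R = "{(x, y). x \<in> X \<and> y \<in> X \<and> (fst x = fst y \<or> e x = e y)}"
  have g: "graph_components D = gen_class ?R ` X" by (simp add: graph_components_def gen_classes_def)
  have fin: "finite (graph_components D)" unfolding g using finite_darts by simp
  have "component_sets \<subseteq> Union ` Pow (graph_components D)"
  proof
    fix U assume U: "U \<in> component_sets"
    then have UX: "U \<subseteq> X" by (auto simp: component_sets_def vertex_sets_def)
    have "gen_class ?R x \<subseteq> U" if "x \<in> U" for x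
    proof (rule gen_class_closed_subset[OF that])
      fix x y assume "(x, y) \<in> ?R"
      then show "x \<in> U \<longleftrightarrow> y \<in> U"
        using U edge_eq_iff[of x y] by (auto simp: component_sets_def vertex_sets_def)
    qed
    then have "U = \<Union> (gen_class ?R ` U)" using gen_class_refl by fast
    moreover have "gen_class ?R ` U \<in> Pow (graph_components D)" using UX unfolding g by blast
    ultimately show "U \<in> Union ` Pow (graph_components D)" by blast
  qed
  then have "card component_sets \<le> card (Pow (graph_components D))"
    using fin by (meson card_image_le card_mono finite_Pow_iff finite_imageI le_trans)
  then show ?thesis using fin by (simp add: card_Pow)
qed

lemma vertex_set_if_rot:
  assumes "\<And>x. x \<in> X \<Longrightarrow> x \<in> U \<longleftrightarrow> rot x \<in> U" "x \<in> X" "y \<in> X" "fst x = fst y"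
  shows "x \<in> U \<longleftrightarrow> y \<in> U"
proof -
  have "(c, p) \<in> U \<longleftrightarrow> (c, 0) \<in> U" if "c < n" "p < 4" for c p
  proof -
    have r: "(c, q) \<in> U \<longleftrightarrow> (c, q') \<in> U" if "q < 4" "q' = Suc q mod 4" for q q'
      using assms(1)[of "(c, q)"] \<open>c < n\<close> that by (auto simp: rot_def darts_def)
    have "p = 0 \<or> p = 1 \<or> p = 2 \<or> p = 3" using that by auto
    moreover have "(c, 0) \<in> U \<longleftrightarrow> (c, 1) \<in> U" "(c, 1) \<in> U \<longleftrightarrow> (c, 2) \<in> U" "(c, 2) \<in> U \<longleftrightarrow> (c, 3) \<in> U"
      by (rule r; simp)+
    ultimately show ?thesis by (elim disjE) simp_all
  qed
  then have "z \<in> U \<longleftrightarrow> (fst z, 0) \<in> U" if "z \<in> X" for z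
    using that by (metis SigmaE darts_def fst_conv lessThan_iff)
  then show ?thesis using assms(2-4) by metis
qed

text \<open>
  A set of darts without coboundary contains with each dart the opposite one. If it also consists of
  whole faces or of whole vertices, it consists of whole components of the graph.
\<close>
lemma coboundary_kernel:
  "{U \<in> face_sets. coboundary U = {}} \<subseteq> component_sets" "{U \<in> vertex_sets. coboundary U = {}} \<subseteq> component_sets"
proof -
  have o: "x \<in> U \<longleftrightarrow> opp x \<in> U" if "coboundary U = {}" "U \<subseteq> X" "x \<in> X" for x U
    using mem_coboundary[OF that(2,3)] that(1) by auto
  show "{U \<in> vertex_sets. coboundary U = {}} \<subseteq> component_sets"
    using o by (auto simp: component_sets_def vertex_sets_def)
  show "{U \<in> face_sets. coboundary U = {}} \<subseteq> component_sets"
  proof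
    fix U assume "U \<in> {U \<in> face_sets. coboundary U = {}}"
    then have U: "U \<subseteq> X" "coboundary U = {}" "\<And>x. x \<in> X \<Longrightarrow> x \<in> U \<longleftrightarrow> face_step x \<in> U"
      by (auto simp: face_sets_def)
    have "x \<in> U \<longleftrightarrow> rot x \<in> U" if "x \<in> X" for x
      using U(3)[of "opp x"] o[OF U(2,1), of x] that opp opp_opp by (auto simp: face_step_def)
    then have "x \<in> U \<longleftrightarrow> y \<in> U" if "x \<in> X" "y \<in> X" "fst x = fst y" for x y
      using vertex_set_if_rot[of U x y] that by blast
    then have "U \<in> vertex_sets" using U(1) unfolding vertex_sets_def by blast
    then show "U \<in> component_sets" using o[OF U(2,1)] by (auto simp: component_sets_def)
  qed
qed

lemma finite_component_sets: "finite component_sets"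
  using finite_sets(2) by (simp add: component_sets_def)

text \<open>
  Cocycles are coboundaries on a union of spheres. Let \<open>n\<close>, \<open>F\<close> and \<open>k\<close> be the numbers of crossings,
  faces and components. Both kernels of \<open>coboundary\<close> have dimension at most \<open>k\<close>, so the coboundaries of
  vertex sets have dimension at least \<open>n - k\<close>, and the boundaries of face sets have dimension at least
  \<open>F - k\<close>, whence their annihilator, the cocycles, has dimension at most \<open>2 n - F + k\<close>. Euler's formula
  \<open>F = n + 2 k\<close> makes this bound \<open>n - k\<close>, and since coboundaries are cocycles, the two spaces agree.
\<close>
lemma coboundary_if_even_on_faces:
  assumes "z \<subseteq> e ` X" "\<And>U. U \<in> face_sets \<Longrightarrow> even (card (coboundary U \<inter> z))"
  shows "z \<in> coboundary ` vertex_sets"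
proof -
  let ?C = "coboundary ` face_sets" and ?B = "coboundary ` vertex_sets" and ?E = "e ` X"
  let ?Z = "{z \<in> Pow ?E. \<forall>c\<in>?C. even (card (c \<inter> z))}"
  let ?k = "card (graph_components D)" and ?f = "card (faces D)"
  have finE: "finite ?E" using finite_darts by simp
  have sub: "U \<subseteq> X" if "U \<in> face_sets \<or> U \<in> vertex_sets" for U
    using that by (auto simp: face_sets_def vertex_sets_def)
  have "2 ^ ?f \<le> card ?C * card {U \<in> face_sets. coboundary U = {}}"
    using card_face_sets card_le_image_times_kernel[OF finite_sets(1) sym_diff_sets(1), of coboundary]
      coboundary_sym_diff sub by (meson le_trans)
  also have "card {U \<in> face_sets. coboundary U = {}} \<le> 2 ^ ?k"
    using card_mono[OF finite_component_sets coboundary_kernel(1)] card_component_sets by (rule le_trans)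
  finally have C: "2 ^ ?f \<le> card ?C * 2 ^ ?k" by simp
  have "2 ^ n \<le> card ?B * card {U \<in> vertex_sets. coboundary U = {}}"
    using card_vertex_sets card_le_image_times_kernel[OF finite_sets(2) sym_diff_sets(2), of coboundary]
      coboundary_sym_diff sub by (meson le_trans)
  also have "card {U \<in> vertex_sets. coboundary U = {}} \<le> 2 ^ ?k"
    using card_mono[OF finite_component_sets coboundary_kernel(2)] card_component_sets by (rule le_trans)
  finally have B: "2 ^ n \<le> card ?B * 2 ^ ?k" by simp
  have CZ: "card ?C * card ?Z = 2 ^ (2 * n)"
    unfolding card_edges[symmetric]
  proof (rule card_annihilator[OF finE])
    show "?C \<subseteq> Pow ?E" using sub coboundary_subset by blast
    have "{} \<in> face_sets" "coboundary {} = {}" by (auto simp: face_sets_def coboundary_def)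
    then show "{} \<in> ?C" by force
    fix a b assume "a \<in> ?C" "b \<in> ?C"
    then obtain U W where "U \<in> face_sets" "W \<in> face_sets" "a = coboundary U" "b = coboundary W" by auto
    then show "sym_diff a b \<in> ?C" using coboundary_sym_diff[of U W] sub sym_diff_sets(1) by (metis imageI)
  qed
  have euler: "?f = n + 2 * ?k" using oriented by (simp add: oriented_link_diagram_def planar_def)
  have "2 ^ ?f * card ?Z \<le> 2 ^ ?k * (card ?C * card ?Z)" using C by (simp add: mult.commute mult.left_commute)
  then have "2 ^ n * 2 ^ ?k * (2 ^ ?k * card ?Z) \<le> 2 ^ n * 2 ^ ?k * 2 ^ n"
    unfolding CZ euler by (simp add: power_add power_mult power2_eq_square mult_2 ac_simps)
  then have "2 ^ ?k * card ?Z \<le> 2 ^ n" by simp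
  also note B
  finally have ZB: "card ?Z \<le> card ?B" by simp
  have "?B \<subseteq> ?Z"
  proof
    fix b assume "b \<in> ?B"
    then obtain W where W: "W \<in> vertex_sets" "b = coboundary W" by auto
    have "even (card (coboundary U \<inter> b))" if U: "U \<in> face_sets" for U
    proof (rule even_coboundary_Int[OF U, where g = "\<lambda>x. x \<in> W"])
      show bE: "b \<subseteq> ?E" using W sub coboundary_subset by blast
      fix x assume x: "x \<in> X"
      have "opp x \<in> W \<longleftrightarrow> face_step x \<in> W"
        by (rule vertex_setsD[OF W(1) opp(1)[OF x] face_step[OF x]]) (simp add: face_step_def rot_def)
      then show "e x \<in> b \<longleftrightarrow> (x \<in> W) \<noteq> (face_step x \<in> W)"
        using mem_coboundary[OF sub x, of W] W by blast
    qed
    moreover have "b \<subseteq> ?E" using W sub coboundary_subset by blast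
    ultimately show "b \<in> ?Z" by blast
  qed
  with ZB have "?B = ?Z" using finE by (intro card_seteq) simp_all
  moreover have "z \<in> ?Z" using assms by blast
  ultimately show ?thesis by (simp only:)
qed

text \<open>
  The parity of the position of a dart alternates around each crossing, but need not alternate along
  the edges. The edges along which it fails to alternate form a cocycle, because they are the ones at
  which the parity changes on the walk around a face. Hence they are the coboundary of a set of
  crossings, and exchanging the two parities at these crossings repairs all edges.
\<close>
lemma alternating_orientation:
  "\<exists>inward. (\<forall>x\<in>X. inward (opp x) \<longleftrightarrow> \<not> inward x) \<and> (\<forall>x\<in>X. inward (rot x) \<longleftrightarrow> \<not> inward x)"
proof -
  let ?z = "{e x | x. x \<in> X \<and> (odd (snd x) \<longleftrightarrow> odd (snd (opp x)))}"
  have z: "e x \<in> ?z \<longleftrightarrow> (odd (snd x) \<longleftrightarrow> odd (snd (opp x)))" if x: "x \<in> X" for x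
  proof
    assume "e x \<in> ?z"
    then obtain y where "y \<in> X" "e x = e y" "odd (snd y) \<longleftrightarrow> odd (snd (opp y))" by blast
    moreover have "y = x \<or> y = opp x" using calculation edge_eq_iff[OF x, of y] by blast
    ultimately show "odd (snd x) \<longleftrightarrow> odd (snd (opp x))" using opp_opp[OF x] by force
  next
    assume "odd (snd x) \<longleftrightarrow> odd (snd (opp x))"
    then show "e x \<in> ?z" using x by blast
  qed
  have r: "odd (snd (rot x)) \<longleftrightarrow> even (snd x)" for x
    by (simp add: rot_def) presburger
  have "?z \<in> coboundary ` vertex_sets"
  proof (rule coboundary_if_even_on_faces)
    fix U assume "U \<in> face_sets"
    then show "even (card (coboundary U \<inter> ?z))"
    proof (rule even_coboundary_Int[where g = "\<lambda>x. odd (snd x)"])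
      show "?z \<subseteq> e ` X" by blast
      fix x assume "x \<in> X"
      then show "e x \<in> ?z \<longleftrightarrow> odd (snd x) \<noteq> odd (snd (face_step x))"
        by (simp only: z face_step_def r) blast
    qed
  next
    show "?z \<subseteq> e ` X" by blast
  qed
  then obtain W where W: "W \<in> vertex_sets" "coboundary W = ?z" by auto
  then have WX: "W \<subseteq> X" by (auto simp: vertex_sets_def)
  let ?inward = "\<lambda>x. odd (snd x) \<noteq> (x \<in> W)"
  have "?inward (opp x) \<longleftrightarrow> \<not> ?inward x" if "x \<in> X" for x
    using mem_coboundary[OF WX that] z[OF that] unfolding W(2) by argo
  moreover have "?inward (rot x) \<longleftrightarrow> \<not> ?inward x" if "x \<in> X" for x
    using vertex_setsD[OF W(1) that rot[OF that]] r[of x] by (simp add: rot_def)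
  ultimately show ?thesis by (intro exI[of _ ?inward] conjI ballI)
qed

end

section \<open>Composing a permutation with a transposition\<close>
lemma orbit_subset_closed:
  assumes "f a \<in> S" "\<And>x. x \<in> S \<Longrightarrow> f x \<in> S" shows "orbit f a \<subseteq> S"
proof
  fix x assume "x \<in> orbit f a" then show "x \<in> S" by induction (use assms in auto)
qed

lemma orbit_eq_if_mem:
  assumes "permutation f" "y \<in> orbit f x" shows "orbit f y = orbit f x"
proof -
  have "x \<in> orbit f y" using orbit_swap[OF permutation_self_in_orbit[OF assms(1)] assms(2)] .
  then show ?thesis using assms(2) orbit_trans by (metis subsetI subset_antisym)
qed

text \<open>
  If \<open>b = f\<^sup>k a\<close> with \<open>k > 0\<close> minimal, then \<open>f \<circ> transpose a b\<close> maps \<open>b\<close> to \<open>f a\<close> and then follows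
  \<open>f\<close> until it is back at \<open>b\<close>, without meeting \<open>a\<close>.
\<close>
lemma orbit_transpose_split:
  assumes ab: "a \<noteq> b" and b: "b \<in> orbit f a"
  shows "a \<notin> orbit (f \<circ> transpose a b) b"
proof -
  let ?g = "f \<circ> transpose a b" and ?P = "\<lambda>k. 0 < k \<and> (f ^^ k) a = b"
  define k where "k = (LEAST k. ?P k)"
  have "\<exists>k. ?P k" using b by (auto simp: orbit_altdef)
  then have k: "0 < k" "(f ^^ k) a = b" and least: "\<And>j. 0 < j \<Longrightarrow> (f ^^ j) a = b \<Longrightarrow> k \<le> j"
    unfolding k_def using LeastI_ex[of ?P] Least_le[of ?P] by auto
  let ?S = "{(f ^^ i) a | i. 0 < i \<and> i \<le> k}"
  have a_not: "(f ^^ i) a \<noteq> a" if "0 < i" "i \<le> k" for i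
  proof
    assume eq: "(f ^^ i) a = a"
    with k ab that have "i < k" by (metis le_neq_implies_less)
    have "(f ^^ (k - i)) ((f ^^ i) a) = (f ^^ k) a"
      using that by (metis comp_apply funpow_add le_add_diff_inverse2)
    then have "(f ^^ (k - i)) a = b" using eq k by simp
    then show False using least[of "k - i"] \<open>i < k\<close> that by simp
  qed
  have fa: "f a \<in> ?S" using k(1) by (intro CollectI exI[of _ 1]) auto
  have "orbit ?g b \<subseteq> ?S"
  proof (rule orbit_subset_closed)
    show "?g b \<in> ?S" using fa by simp
    fix x assume "x \<in> ?S"
    then obtain i where i: "x = (f ^^ i) a" "0 < i" "i \<le> k" by blast
    show "?g x \<in> ?S"
    proof (cases "i = k")
      case True then show ?thesis using fa i k by simp
    next
      case False
      then have "x \<noteq> b" using least[of i] i by auto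
      then have "?g x = (f ^^ Suc i) a" using a_not i by simp
      then show ?thesis using i False by (intro CollectI exI[of _ "Suc i"]) simp
    qed
  qed
  moreover have "a \<notin> ?S"
  proof
    assume "a \<in> ?S"
    then obtain i where i: "a = (f ^^ i) a" "0 < i" "i \<le> k" by blast
    show False using a_not[OF i(2,3)] i(1)[symmetric] by (rule notE)
  qed
  ultimately show ?thesis by (meson subsetD)
qed

text \<open>
  Starting from \<open>b\<close>, the new permutation jumps to \<open>f a\<close> and follows \<open>f\<close> through the whole orbit of \<open>a\<close>
  before it jumps back to the orbit of \<open>b\<close>.
\<close>
lemma orbit_transpose_merge:
  assumes f: "permutation f" and ab: "orbit f a \<noteq> orbit f b"
  shows "orbit (f \<circ> transpose a b) x =
    (if x \<in> orbit f a \<union> orbit f b then orbit f a \<union> orbit f b else orbit f x)"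
proof -
  define g where "g = f \<circ> transpose a b"
  have g: "permutation g" unfolding g_def using f by (simp add: permutation_compose permutation_swap_id)
  have ga: "g a = f b" and gb: "g b = f a" and gf: "\<And>y. y \<noteq> a \<Longrightarrow> y \<noteq> b \<Longrightarrow> g y = f y"
    by (simp_all add: g_def)
  let ?U = "orbit f a \<union> orbit f b"
  note self = permutation_self_in_orbit[OF f]
  have notin: "a \<notin> orbit f b" "b \<notin> orbit f a"
    using ab orbit_eq_if_mem[OF f] by metis+
  have walk: "orbit f c \<subseteq> orbit g d"
    if gd: "g d = f c" and d: "d \<notin> orbit f c" and cd: "\<And>y. y \<noteq> c \<Longrightarrow> y \<noteq> d \<Longrightarrow> g y = f y" for c d
  proof
    fix x assume "x \<in> orbit f c"
    then show "x \<in> orbit g d"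
    proof induction
      case base
      show ?case using orbit.base[of g d] gd by simp
    next
      case (step x)
      have "x \<noteq> d" using step(1) d by blast
      show ?case
      proof (cases "x = c")
        case True then show ?thesis using orbit.base[of g d] gd by simp
      next
        case False
        then have "g x = f x" using \<open>x \<noteq> d\<close> cd by simp
        then show ?thesis using orbit.step[OF step(2)] by simp
      qed
    qed
  qed
  have wab: "orbit f a \<subseteq> orbit g b" "orbit f b \<subseteq> orbit g a"
    by (rule walk; use ga gb gf notin in blast)+
  then have "a \<in> orbit g b" using self by blast
  then have eq: "orbit g a = orbit g b" by (rule orbit_eq_if_mem[OF g])
  have "orbit g a \<subseteq> ?U"
  proof (rule orbit_subset_closed)
    show "g a \<in> ?U" by (simp add: ga orbit.base)
    fix x assume x: "x \<in> ?U"
    show "g x \<in> ?U"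
    proof (cases "x = a \<or> x = b")
      case True then show ?thesis by (auto simp: ga gb orbit.base)
    next
      case False then show ?thesis using x by (auto simp: gf intro: orbit.step)
    qed
  qed
  with wab eq have U: "orbit g a = ?U" by blast
  have "orbit g x = (if x \<in> ?U then ?U else orbit f x)"
  proof (cases "x \<in> ?U")
    case True
    then have "x \<in> orbit g a" using U by simp
    then have "orbit g x = orbit g a" by (rule orbit_eq_if_mem[OF g])
    then show ?thesis using True U by simp
  next
    case False
    have fg: "g y = f y" if y: "y \<in> orbit f x" for y
    proof (rule gf)
      show "y \<noteq> a" "y \<noteq> b" using y False self[of x] orbit_eq_if_mem[OF f y] by blast+
    qed
    have "orbit f x \<subseteq> orbit g x"
    proof
      fix y assume "y \<in> orbit f x"
      then show "y \<in> orbit g x"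
      proof induction
        case base show ?case using orbit.base[of g x] fg[OF self] by simp
      next
        case (step y) then show ?case using orbit.step[OF step(2)] fg[of y] by simp
      qed
    qed
    moreover have "orbit g x \<subseteq> orbit f x"
    proof (rule orbit_subset_closed)
      show "g x \<in> orbit f x" using fg[OF self] orbit.base[of f x] by simp
      show "g y \<in> orbit f x" if "y \<in> orbit f x" for y using fg[OF that] orbit.step[OF that] by simp
    qed
    ultimately show ?thesis using False by auto
  qed
  then show ?thesis by (simp only: g_def)
qed

section \<open>Loops of a state as orbits\<close>
context diagram
begin

text \<open>
  A fixed alternating orientation of the edges: \<open>inward x\<close> means that the edge at the dart \<open>x\<close> is
  directed towards the crossing. It is unrelated to the orientation of the link.
\<close>
definition inward :: "nat \<times> nat \<Rightarrow> bool" where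
  "inward = (SOME inward. (\<forall>x\<in>X. inward (opp x) \<longleftrightarrow> \<not> inward x) \<and> (\<forall>x\<in>X. inward (rot x) \<longleftrightarrow> \<not> inward x))"

lemma inward: assumes "x \<in> X" shows "inward (opp x) \<longleftrightarrow> \<not> inward x" "inward (rot x) \<longleftrightarrow> \<not> inward x"
  using someI_ex[OF alternating_orientation] assms unfolding inward_def[symmetric] by blast+

lemma inward_adjacent:
  assumes "c < n"
  shows "inward (c, 1) \<longleftrightarrow> \<not> inward (c, 0)" "inward (c, 2) \<longleftrightarrow> inward (c, 0)" "inward (c, 3) \<longleftrightarrow> \<not> inward (c, 0)"
proof -
  have "rot (c, 0) = (c, 1)" "rot (c, 1) = (c, 2)" "rot (c, 2) = (c, 3)" by (simp_all add: rot_def)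
  then show "inward (c, 1) \<longleftrightarrow> \<not> inward (c, 0)" "inward (c, 2) \<longleftrightarrow> inward (c, 0)" "inward (c, 3) \<longleftrightarrow> \<not> inward (c, 0)"
    using inward(2)[of "(c, 0)"] inward(2)[of "(c, 1)"] inward(2)[of "(c, 2)"] assms by (simp_all add: darts_def)
qed

lemma same_direction_edge: "x \<in> X \<Longrightarrow> y \<in> X \<Longrightarrow> inward x = inward y \<Longrightarrow> e x = e y \<Longrightarrow> x = y"
  using edge_eq_iff[of x y] inward(1)[of x] by auto

text \<open>
  The other end of the strand of the smoothing that contains the given dart.
\<close>
definition partner :: "nat set \<Rightarrow> nat \<times> nat \<Rightarrow> nat \<times> nat" where
  "partner \<sigma> x = (fst x, if fst x \<in> \<sigma> then 3 - snd x else (if even (snd x) then snd x + 1 else snd x - 1))"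

lemma dart_cases:
  assumes "x \<in> X"
  obtains c where "c < n" "x = (c, 0)" | c where "c < n" "x = (c, 1)"
    | c where "c < n" "x = (c, 2)" | c where "c < n" "x = (c, 3)"
proof -
  obtain c p where x: "x = (c, p)" "c < n" "p < 4" using assms by (auto simp: darts_def)
  then have "p = 0 \<or> p = 1 \<or> p = 2 \<or> p = 3" by auto
  then show thesis using x that by blast
qed

lemma partner:
  assumes "x \<in> X"
  shows "partner \<sigma> x \<in> X" "partner \<sigma> (partner \<sigma> x) = x" "inward (partner \<sigma> x) \<longleftrightarrow> \<not> inward x"
  by (rule dart_cases[OF assms]; simp add: partner_def darts_def inward_adjacent[simplified])+

lemma smoothing_arcs_iff:
  "(a, b) \<in> (\<Union>c<n. smoothing_arcs D \<sigma> c) \<or> (b, a) \<in> (\<Union>c<n. smoothing_arcs D \<sigma> c)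
    \<longleftrightarrow> (\<exists>x\<in>X. a = e x \<and> b = e (partner \<sigma> x))" (is "?L \<longleftrightarrow> ?R")
proof
  assume ?L
  then obtain c where c: "c < n" "(a, b) \<in> smoothing_arcs D \<sigma> c \<or> (b, a) \<in> smoothing_arcs D \<sigma> c" by blast
  have d: "(c, 0) \<in> X" "(c, 1) \<in> X" "(c, 2) \<in> X" "(c, 3) \<in> X" using c by (simp_all add: darts_def)
  have "\<exists>x\<in>{(c, 0), (c, 1), (c, 2), (c, 3)}. a = e x \<and> b = e (partner \<sigma> x)"
    using c(2) by (cases "c \<in> \<sigma>") (auto simp: smoothing_arcs_def partner_def)
  then show ?R using d by blast
next
  assume ?R
  then obtain x where x: "x \<in> X" "a = e x" "b = e (partner \<sigma> x)" by blast
  from x(1) obtain c where "c < n" "(a, b) \<in> smoothing_arcs D \<sigma> c \<or> (b, a) \<in> smoothing_arcs D \<sigma> c"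
    by (cases rule: dart_cases; cases "fst x \<in> \<sigma>") (auto simp: x(2,3) smoothing_arcs_def partner_def)
  then show ?L by blast
qed

definition head :: "nat \<Rightarrow> nat \<times> nat" where
  "head y = (THE x. x \<in> X \<and> inward x \<and> e x = y)"

lemma head_edge: "x \<in> X \<Longrightarrow> inward x \<Longrightarrow> head (e x) = x"
  unfolding head_def by (rule the_equality) (use same_direction_edge in auto)

lemma head:
  assumes "y \<in> e ` X" shows "head y \<in> X" "inward (head y)" "e (head y) = y"
proof -
  obtain x where x: "x \<in> X" "y = e x" using assms by blast
  define z where "z = (if inward x then x else opp x)"
  have "z \<in> X" "inward z" "e z = y" using x opp[OF x(1)] inward(1)[OF x(1)] by (auto simp: z_def)
  then show "head y \<in> X" "inward (head y)" "e (head y) = y" using head_edge[of z] by auto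
qed

text \<open>
  The edge that follows \<open>y\<close> on its loop in the direction given by \<open>inward\<close>. Circles without crossings
  are fixed points.
\<close>
definition next_edge :: "nat set \<Rightarrow> nat \<Rightarrow> nat" where
  "next_edge \<sigma> y = (if y \<in> e ` X then e (partner \<sigma> (head y)) else y)"

text \<open>
  Both strands of either smoothing join an inward dart to an outward one, since they join neighbouring
  positions. So the predecessor of an edge can be recovered from its outward end.
\<close>
lemma permutation_next_edge: "permutation (next_edge \<sigma>)"
proof -
  have "inj_on (next_edge \<sigma>) (e ` X)"
  proof (rule inj_onI)
    fix y z assume yz: "y \<in> e ` X" "z \<in> e ` X" "next_edge \<sigma> y = next_edge \<sigma> z"
    note hy = head[OF yz(1)] and hz = head[OF yz(2)]
    have "partner \<sigma> (head y) = partner \<sigma> (head z)"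
      by (rule same_direction_edge) (use yz hy hz partner in \<open>simp_all add: next_edge_def\<close>)
    then have "head y = head z" using partner(2)[OF hy(1), of \<sigma>] partner(2)[OF hz(1), of \<sigma>] by argo
    then show "y = z" using hy(3) hz(3) by argo
  qed
  moreover have "next_edge \<sigma> ` e ` X \<subseteq> e ` X"
  proof
    fix z assume "z \<in> next_edge \<sigma> ` e ` X"
    then obtain y where "y \<in> e ` X" "z = e (partner \<sigma> (head y))" by (auto simp: next_edge_def)
    then show "z \<in> e ` X" using head(1) partner(1) by blast
  qed
  ultimately have "bij_betw (next_edge \<sigma>) (e ` X) (e ` X)"
    using finite_darts by (simp add: bij_betw_def endo_inj_surj)
  then have "next_edge \<sigma> permutes (e ` X)"
    by (rule bij_imp_permutes) (simp add: next_edge_def)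
  then show ?thesis using finite_darts permutation_permutes by blast
qed

lemma loop_of_eq_orbit: "loop_of D \<sigma> y = orbit (next_edge \<sigma>) y"
proof
  let ?R = "\<Union>c<n. smoothing_arcs D \<sigma> c" and ?f = "next_edge \<sigma>"
  note self = permutation_self_in_orbit[OF permutation_next_edge]
  show "loop_of D \<sigma> y \<subseteq> orbit ?f y"
    unfolding loop_of_def
  proof (rule gen_class_closed_subset[OF self])
    fix a b assume "(a, b) \<in> ?R"
    then obtain x where x: "x \<in> X" "a = e x" "b = e (partner \<sigma> x)" using smoothing_arcs_iff by blast
    have mem: "u \<in> orbit ?f y \<longleftrightarrow> ?f u \<in> orbit ?f y" for u
      using orbit.step[of u ?f y] orbit.base[of ?f u] self orbit_eq_if_mem[OF permutation_next_edge] by metis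
    show "a \<in> orbit ?f y \<longleftrightarrow> b \<in> orbit ?f y"
    proof (cases "inward x")
      case True
      then have "?f a = b" using x head_edge[of x] by (simp add: next_edge_def)
      then show ?thesis using mem[of a] by simp
    next
      case False
      then have "head b = partner \<sigma> x" using x partner[of x \<sigma>] head_edge[of "partner \<sigma> x"] by simp
      then have "?f b = a" using x partner[of x \<sigma>] by (simp add: next_edge_def)
      then show ?thesis using mem[of b] by simp
    qed
  qed
  have step: "?f u \<in> gen_class ?R y" if "u \<in> gen_class ?R y" for u
  proof (cases "u \<in> e ` X")
    case True
    have "(u, ?f u) \<in> ?R \<or> (?f u, u) \<in> ?R"
      unfolding smoothing_arcs_iff
      using head[OF True] True by (intro bexI[of _ "head u"]) (simp_all add: next_edge_def)
    then show ?thesis using gen_class_step[OF _ that] by blast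
  qed (use that in \<open>simp add: next_edge_def\<close>)
  then show "orbit ?f y \<subseteq> loop_of D \<sigma> y"
    unfolding loop_of_def by (intro orbit_subset_closed step gen_class_refl)
qed

lemma loop_of_refl: "y \<in> loop_of D \<sigma> y" by (simp add: loop_of_def gen_class_refl)

lemma loop_of_eq: "z \<in> loop_of D \<sigma> y \<Longrightarrow> loop_of D \<sigma> z = loop_of D \<sigma> y"
  unfolding loop_of_def by (rule gen_class_eq)

lemma loop_of_partner: "x \<in> X \<Longrightarrow> loop_of D \<sigma> (e (partner \<sigma> x)) = loop_of D \<sigma> (e x)"
proof (rule loop_of_eq)
  assume "x \<in> X"
  then have "(e x, e (partner \<sigma> x)) \<in> (\<Union>c<n. smoothing_arcs D \<sigma> c) \<or> (e (partner \<sigma> x), e x) \<in> (\<Union>c<n. smoothing_arcs D \<sigma> c)"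
    unfolding smoothing_arcs_iff by (intro bexI[of _ x]) simp_all
  then show "e (partner \<sigma> x) \<in> loop_of D \<sigma> (e x)"
    unfolding loop_of_def by (rule gen_class_step[OF _ gen_class_refl])
qed

text \<open>
  The inward darts at \<open>c\<close> are the ones at positions \<open>head_pos c\<close> and \<open>head_pos c + 2\<close>; in every state,
  they lie on the two strands at \<open>c\<close>.
\<close>
definition head_pos :: "nat \<Rightarrow> nat" where
  "head_pos c = (if inward (c, 0) then 0 else 1)"

lemma head_pos:
  assumes c: "c < n"
  shows "head_pos c = 0 \<or> head_pos c = 1" "(c, head_pos c) \<in> X" "(c, head_pos c + 2) \<in> X"
    "inward (c, head_pos c)" "inward (c, head_pos c + 2)"
    "\<And>x. x \<in> X \<Longrightarrow> fst x = c \<Longrightarrow> inward x \<Longrightarrow> x = (c, head_pos c) \<or> x = (c, head_pos c + 2)"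
    "trace_loops D \<sigma> c = {loop_of D \<sigma> (e (c, head_pos c)), loop_of D \<sigma> (e (c, head_pos c + 2))}"
    "mergetrace D \<sigma> c \<longleftrightarrow> loop_of D \<sigma> (e (c, head_pos c)) \<noteq> loop_of D \<sigma> (e (c, head_pos c + 2))"
proof -
  let ?p = "head_pos c"
  have X: "(c, 0) \<in> X" "(c, 1) \<in> X" "(c, 2) \<in> X" "(c, 3) \<in> X" using c by (simp_all add: darts_def)
  have lp: "loop_of D \<sigma> (e (c, 1)) = (if c \<in> \<sigma> then loop_of D \<sigma> (e (c, 2)) else loop_of D \<sigma> (e (c, 0)))"
    "loop_of D \<sigma> (e (c, 3)) = (if c \<in> \<sigma> then loop_of D \<sigma> (e (c, 0)) else loop_of D \<sigma> (e (c, 2)))" for \<sigma>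
    using loop_of_partner[OF X(2), of \<sigma>] loop_of_partner[OF X(4), of \<sigma>] by (auto simp: partner_def)
  show "x = (c, ?p) \<or> x = (c, ?p + 2)" if "x \<in> X" "fst x = c" "inward x" for x
    using that by (cases rule: dart_cases) (auto simp: inward_adjacent[simplified] c head_pos_def)
  show "trace_loops D \<sigma> c = {loop_of D \<sigma> (e (c, ?p)), loop_of D \<sigma> (e (c, ?p + 2))}"
    "mergetrace D \<sigma> c \<longleftrightarrow> loop_of D \<sigma> (e (c, ?p)) \<noteq> loop_of D \<sigma> (e (c, ?p + 2))"
    using lp[of \<sigma>]
    by (cases "inward (c, 0)"; cases "c \<in> \<sigma>";
        simp add: trace_loops_def mergetrace_def strand1_def strand2_def insert_commute eval_nat_numeral
          eq_commute head_pos_def)+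
qed (use c inward_adjacent[OF c] in \<open>simp_all add: eval_nat_numeral head_pos_def darts_def\<close>)

text \<open>
  Changing the smoothing exchanges the two outward partners of the inward darts.
\<close>
lemma next_edge_toggle:
  assumes c: "c < n"
  shows "next_edge (sym_diff \<sigma> {c}) =
    next_edge \<sigma> \<circ> transpose (e (c, head_pos c)) (e (c, head_pos c + 2))"
proof
  fix y
  let ?a = "e (c, head_pos c)" and ?b = "e (c, head_pos c + 2)"
  note p = head_pos[OF c]
  have h: "head ?a = (c, head_pos c)" "head ?b = (c, head_pos c + 2)"
    by (rule head_edge[OF p(2,4)], rule head_edge[OF p(3,5)])
  have E: "?a \<in> e ` X" "?b \<in> e ` X" by (rule imageI[OF p(2)], rule imageI[OF p(3)])
  have sw: "partner (sym_diff \<sigma> {c}) (c, head_pos c) = partner \<sigma> (c, head_pos c + 2)"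
    "partner (sym_diff \<sigma> {c}) (c, head_pos c + 2) = partner \<sigma> (c, head_pos c)"
    using p(1) by (auto simp: partner_def)
  show "next_edge (sym_diff \<sigma> {c}) y = (next_edge \<sigma> \<circ> transpose ?a ?b) y"
  proof (cases "y = ?a \<or> y = ?b")
    case True
    then show ?thesis
    proof
      assume y: "y = ?a"
      show ?thesis unfolding y by (simp only: next_edge_def o_apply transpose_apply_first E h sw if_True)
    next
      assume y: "y = ?b"
      show ?thesis unfolding y by (simp only: next_edge_def o_apply transpose_apply_second E h sw if_True)
    qed
  next
    case False
    then have t: "transpose ?a ?b y = y" by simp
    show ?thesis
    proof (cases "y \<in> e ` X")
      case True
      have "fst (head y) \<noteq> c" using p(6)[of "head y"] head[OF True] False by auto
      then have "partner (sym_diff \<sigma> {c}) (head y) = partner \<sigma> (head y)" by (auto simp: partner_def)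
      then show ?thesis using t True by (simp add: next_edge_def)
    qed (use t in \<open>simp add: next_edge_def\<close>)
  qed
qed

lemma loop_of_toggle_merge:
  assumes c: "c < n" and "mergetrace D \<sigma> c"
  shows "loop_of D (sym_diff \<sigma> {c}) y =
    (if y \<in> strand1 D \<sigma> c \<union> strand2 D \<sigma> c then strand1 D \<sigma> c \<union> strand2 D \<sigma> c else loop_of D \<sigma> y)"
proof -
  let ?a = "e (c, head_pos c)" and ?b = "e (c, head_pos c + 2)"
  have "\<Union> (trace_loops D \<sigma> c) = loop_of D \<sigma> ?a \<union> loop_of D \<sigma> ?b" by (simp add: head_pos(7)[OF c])
  then have U: "strand1 D \<sigma> c \<union> strand2 D \<sigma> c = loop_of D \<sigma> ?a \<union> loop_of D \<sigma> ?b"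
    by (simp add: trace_loops_def)
  have "orbit (next_edge \<sigma>) ?a \<noteq> orbit (next_edge \<sigma>) ?b"
    using assms(2) head_pos(8)[OF c] by (simp add: loop_of_eq_orbit)
  from orbit_transpose_merge[OF permutation_next_edge this, of y]
  show ?thesis unfolding U unfolding loop_of_eq_orbit next_edge_toggle[OF c] .
qed

text \<open>
  No change of smoothing turns one loop into one loop: the two edges that enter the crossing lie on one
  orbit, and composing with the transposition that exchanges them separates them.
\<close>
lemma toggle_pinch:
  assumes c: "c < n" and "\<not> mergetrace D \<sigma> c"
  shows "mergetrace D (sym_diff \<sigma> {c}) c"
proof -
  let ?a = "e (c, head_pos c)" and ?b = "e (c, head_pos c + 2)"
  note p = head_pos[OF c]
  have ab: "?a \<noteq> ?b"
  proof
    assume "?a = ?b"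
    with p(4,5) have "(c, head_pos c) = (c, head_pos c + 2)" by (intro same_direction_edge p(2,3)) simp_all
    then show False by simp
  qed
  have "loop_of D \<sigma> ?a = loop_of D \<sigma> ?b" using assms(2) p(8)[of \<sigma>] by argo
  then have "?b \<in> orbit (next_edge \<sigma>) ?a"
    using loop_of_refl[of ?b \<sigma>] by (simp add: loop_of_eq_orbit)
  from orbit_transpose_split[OF ab this]
  have "?a \<notin> loop_of D (sym_diff \<sigma> {c}) ?b" unfolding loop_of_eq_orbit next_edge_toggle[OF c] .
  then show ?thesis unfolding p(8) using loop_of_refl by metis
qed

end

context diagram
begin

section \<open>Adjacent states of the cube\<close>
lemma edge_in_edges: "x \<in> X \<Longrightarrow> e x \<in> edges D"
  using oriented by (auto simp: oriented_link_diagram_def)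

lemma crossing_edges: "c < n \<Longrightarrow> e (c, 0) \<in> edges D" "c < n \<Longrightarrow> e (c, 2) \<in> edges D"
  by (simp_all add: edge_in_edges darts_def)

lemma loops_eq: "loops D \<sigma> = loop_of D \<sigma> ` edges D"
  by (simp add: loops_def loop_of_def gen_classes_def)

lemma strand_in_loops:
  "c < n \<Longrightarrow> strand1 D \<sigma> c \<in> loops D \<sigma>" "c < n \<Longrightarrow> strand2 D \<sigma> c \<in> loops D \<sigma>"
  by (simp_all add: loops_eq strand1_def strand2_def crossing_edges)

lemma loop_of_mem: "L \<in> loops D \<sigma> \<Longrightarrow> y \<in> L \<Longrightarrow> loop_of D \<sigma> y = L"
  using loop_of_eq by (auto simp: loops_eq)

lemma loop_nonempty: "L \<in> loops D \<sigma> \<Longrightarrow> \<exists>y. y \<in> L"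
  using loop_of_refl by (auto simp: loops_eq)

lemma loops_disjoint: "L \<in> loops D \<sigma> \<Longrightarrow> M \<in> loops D \<sigma> \<Longrightarrow> y \<in> L \<Longrightarrow> y \<in> M \<Longrightarrow> L = M"
  using loop_of_mem by metis

lemma finite_loops: "finite (loops D \<sigma>)"
  using oriented by (simp add: loops_eq oriented_link_diagram_def)

text \<open>
  Going from \<open>\<sigma>\<close> to \<open>\<tau>\<close> by changing the smoothing at \<open>c\<close> merges the loops \<open>A\<close> and \<open>B\<close> to \<open>C\<close>. The
  smoothing may change in either direction, so the same predicate, read from \<open>\<tau>\<close> to \<open>\<sigma>\<close>, describes
  splittings.
\<close>
definition merge_step :: "nat set \<Rightarrow> nat set \<Rightarrow> nat \<Rightarrow> nat set \<Rightarrow> nat set \<Rightarrow> nat set \<Rightarrow> bool" where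
  "merge_step \<sigma> \<tau> c A B C \<longleftrightarrow>
     strand1 D \<sigma> c = A \<and> strand2 D \<sigma> c = B \<and> A \<noteq> B \<and> strand1 D \<tau> c = C \<and> strand2 D \<tau> c = C \<and>
     A \<in> loops D \<sigma> \<and> B \<in> loops D \<sigma> \<and> C \<notin> loops D \<sigma> \<and>
     loops D \<tau> = insert C (loops D \<sigma> - {A, B}) \<and>
     (\<forall>y. loop_of D \<tau> y = (if loop_of D \<sigma> y \<in> {A, B} then C else loop_of D \<sigma> y))"

lemma merge_stepD:
  assumes "merge_step \<sigma> \<tau> c A B C"
  shows "strand1 D \<sigma> c = A" "strand2 D \<sigma> c = B" "A \<noteq> B" "strand1 D \<tau> c = C" "strand2 D \<tau> c = C"
    "A \<in> loops D \<sigma>" "B \<in> loops D \<sigma>" "C \<notin> loops D \<sigma>"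
    "loops D \<tau> = insert C (loops D \<sigma> - {A, B})"
    "loop_of D \<tau> y = (if loop_of D \<sigma> y = A \<or> loop_of D \<sigma> y = B then C else loop_of D \<sigma> y)"
  using assms unfolding merge_step_def by auto

lemma merge_step_sym_diff:
  assumes c: "c < n" and mt: "mergetrace D \<sigma> c"
  obtains A B C where "merge_step \<sigma> (sym_diff \<sigma> {c}) c A B C"
proof
  let ?\<tau> = "sym_diff \<sigma> {c}" and ?A = "strand1 D \<sigma> c" and ?B = "strand2 D \<sigma> c"
  let ?C = "?A \<union> ?B"
  have AB: "?A \<in> loops D \<sigma>" "?B \<in> loops D \<sigma>" using strand_in_loops[OF c] by auto
  have ne: "?A \<noteq> ?B" using mt by (simp add: mergetrace_def)
  have mem: "y \<in> ?C \<longleftrightarrow> loop_of D \<sigma> y = ?A \<or> loop_of D \<sigma> y = ?B" for y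
    using loop_of_mem[OF AB(1)] loop_of_mem[OF AB(2)] loop_of_refl[of y \<sigma>] by blast
  have lp: "loop_of D ?\<tau> y = (if loop_of D \<sigma> y = ?A \<or> loop_of D \<sigma> y = ?B then ?C else loop_of D \<sigma> y)" for y
    unfolding loop_of_toggle_merge[OF c mt, of y] mem by (rule refl)
  have C: "?C \<notin> loops D \<sigma>"
  proof
    assume "?C \<in> loops D \<sigma>"
    then have "?C = ?A" "?C = ?B"
      using loop_nonempty[OF AB(1)] loop_nonempty[OF AB(2)] loops_disjoint AB by blast+
    then show False using ne by simp
  qed
  have lps: "loops D ?\<tau> = insert ?C (loops D \<sigma> - {?A, ?B})"
  proof
    show "loops D ?\<tau> \<subseteq> insert ?C (loops D \<sigma> - {?A, ?B})"
      unfolding loops_eq lp by auto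
    show "insert ?C (loops D \<sigma> - {?A, ?B}) \<subseteq> loops D ?\<tau>"
    proof
      fix L assume "L \<in> insert ?C (loops D \<sigma> - {?A, ?B})"
      then consider "L = ?C" | "L \<in> loops D \<sigma>" "L \<noteq> ?A" "L \<noteq> ?B" by blast
      then show "L \<in> loops D ?\<tau>"
      proof cases
        case 1
        have "loop_of D ?\<tau> (e (c, 0)) = ?C" unfolding lp by (simp add: strand1_def)
        then show ?thesis using 1 crossing_edges(1)[OF c] unfolding loops_eq by blast
      next
        case 2
        then obtain y where y: "y \<in> edges D" "L = loop_of D \<sigma> y" by (auto simp: loops_eq)
        then have "loop_of D ?\<tau> y = L" unfolding lp using 2 by simp
        then show ?thesis using y(1) unfolding loops_eq by blast
      qed
    qed
  qed
  have "strand1 D ?\<tau> c = ?C" "strand2 D ?\<tau> c = ?C"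
    unfolding strand1_def[of D ?\<tau>] strand2_def[of D ?\<tau>] lp by (simp_all add: strand1_def strand2_def)
  then show "merge_step \<sigma> ?\<tau> c ?A ?B ?C"
    unfolding merge_step_def using AB C lps lp ne by simp
qed

lemma merge_step_insert:
  assumes "c < n" "c \<notin> \<sigma>" "mergetrace D \<sigma> c"
  obtains A B C where "merge_step \<sigma> (insert c \<sigma>) c A B C"
proof -
  have "sym_diff \<sigma> {c} = insert c \<sigma>" using assms(2) by auto
  then show thesis using merge_step_sym_diff[OF assms(1,3)] that by metis
qed

lemma merge_step_remove:
  assumes "c < n" "c \<in> \<sigma>" "mergetrace D \<sigma> c"
  obtains A B C where "merge_step \<sigma> (\<sigma> - {c}) c A B C"
proof -
  have "sym_diff \<sigma> {c} = \<sigma> - {c}" using assms(2) by auto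
  then show thesis using merge_step_sym_diff[OF assms(1,3)] that by metis
qed

lemma split_step_insert:
  assumes "c < n" "c \<notin> \<sigma>" "\<not> mergetrace D \<sigma> c"
  obtains A B C where "merge_step (insert c \<sigma>) \<sigma> c A B C"
proof -
  have "sym_diff \<sigma> {c} = insert c \<sigma>" using assms(2) by auto
  then have "mergetrace D (insert c \<sigma>) c" using toggle_pinch[OF assms(1,3)] by simp
  then show thesis using merge_step_remove[OF assms(1), of "insert c \<sigma>"] that assms(2) by auto
qed

lemma split_step_remove:
  assumes "c < n" "c \<in> \<sigma>" "\<not> mergetrace D \<sigma> c"
  obtains A B C where "merge_step (\<sigma> - {c}) \<sigma> c A B C"
proof -
  have "sym_diff \<sigma> {c} = \<sigma> - {c}" using assms(2) by auto
  then have "mergetrace D (\<sigma> - {c}) c" using toggle_pinch[OF assms(1,3)] by simp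
  moreover have "insert c (\<sigma> - {c}) = \<sigma>" using assms(2) by auto
  ultimately show thesis using merge_step_insert[OF assms(1), of "\<sigma> - {c}"] that by auto
qed

lemma edge_coeff_merge:
  assumes "merge_step \<sigma> (insert c \<sigma>) c A B C"
  shows "edge_coeff D c \<sigma> m m' =
    of_bool ((\<forall>L\<in>loops D \<sigma> - {A, B}. m' L = m L) \<and> merge_map (m A) (m B) = Some (m' C))"
proof -
  note s = merge_stepD[OF assms]
  have "loops D \<sigma> \<inter> loops D (insert c \<sigma>) = loops D \<sigma> - {A, B}" unfolding s(9) using s(8) by auto
  then show ?thesis using s(1-5) by (simp add: edge_coeff_def Let_def mergetrace_def)
qed

lemma edge_coeff_split:
  assumes "merge_step (insert c \<sigma>) \<sigma> c A B C"
  shows "edge_coeff D c \<sigma> m m' =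
    of_bool ((\<forall>L\<in>loops D (insert c \<sigma>) - {A, B}. m' L = m L) \<and> (m' A, m' B) \<in> split_map (m C))"
proof -
  note s = merge_stepD[OF assms]
  have "loops D \<sigma> \<inter> loops D (insert c \<sigma>) = loops D (insert c \<sigma>) - {A, B}" unfolding s(9) using s(8) by auto
  then show ?thesis using s(1-5) by (simp add: edge_coeff_def Let_def mergetrace_def)
qed

section \<open>State cycles and boundaries\<close>
lemma finite_enhanced_states: "finite (enhanced_states D)"
proof -
  have "finite (markings D \<sigma>)" for \<sigma>
  proof (rule finite_subset)
    show "markings D \<sigma> \<subseteq> {m. \<forall>L. (L \<in> loops D \<sigma> \<longrightarrow> m L \<in> {Vplus, Vminus}) \<and> (L \<notin> loops D \<sigma> \<longrightarrow> m L = undefined)}"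
      by (auto simp: markings_def intro: mark.exhaust)
    show "finite {m. \<forall>L. (L \<in> loops D \<sigma> \<longrightarrow> m L \<in> {Vplus, Vminus}) \<and> (L \<notin> loops D \<sigma> \<longrightarrow> m L = undefined)}"
      by (rule finite_set_of_finite_funs[OF finite_loops]) simp
  qed
  then show ?thesis unfolding enhanced_states_def states_def by (intro finite_SigmaI) simp_all
qed

lemma differential_basis:
  assumes "s \<in> enhanced_states D"
  shows "differential D (basis_chain s) t = (if t \<in> enhanced_states D then diff_coeff D s t else 0)"
proof -
  have "(\<Sum>r\<in>enhanced_states D. basis_chain s r * diff_coeff D r t) =
      (\<Sum>r\<in>enhanced_states D. if r = s then diff_coeff D r t else 0)"
    by (intro sum.cong) (auto simp: basis_chain_def)
  also have "\<dots> = diff_coeff D s t" using assms finite_enhanced_states by (simp add: sum.delta)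
  finally show ?thesis by (simp add: differential_def)
qed

lemma diff_coeff_insert:
  assumes "c \<in> traces0 D \<sigma>"
  shows "diff_coeff D (\<sigma>, m) (insert c \<sigma>, m') = (-1) ^ card {b \<in> \<sigma>. b < c} * edge_coeff D c \<sigma> m m'"
proof -
  have "insert c \<sigma> = insert b \<sigma> \<longleftrightarrow> b = c" if "b \<in> traces0 D \<sigma>" for b
    using that assms by (auto simp: traces0_def)
  then have "diff_coeff D (\<sigma>, m) (insert c \<sigma>, m') =
      (\<Sum>b\<in>traces0 D \<sigma>. if b = c then (-1) ^ card {a \<in> \<sigma>. a < b} * edge_coeff D b \<sigma> m m' else 0)"
    unfolding diff_coeff_def split by (intro sum.cong refl) simp
  also have "\<dots> = (-1) ^ card {b \<in> \<sigma>. b < c} * edge_coeff D c \<sigma> m m'"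
    using assms by (subst sum.delta) (simp_all add: traces0_def)
  finally show ?thesis .
qed

lemma diff_coeff_eq_0:
  assumes "\<And>b. b \<in> traces0 D \<sigma> \<Longrightarrow> \<tau> = insert b \<sigma> \<Longrightarrow> edge_coeff D b \<sigma> m m' = 0"
  shows "diff_coeff D (\<sigma>, m) (\<tau>, m') = 0"
  unfolding diff_coeff_def split by (rule sum.neutral) (use assms in auto)

lemma edge_coeff_minus_minus:
  assumes "mergetrace D \<sigma> b" "m (strand1 D \<sigma> b) = Vminus" "m (strand2 D \<sigma> b) = Vminus"
  shows "edge_coeff D b \<sigma> m m' = 0"
  using assms by (simp add: edge_coeff_def Let_def)

text \<open>
  The condition on a crossing \<open>b\<close> under which its edge map vanishes on the enhanced state: merging two
  \<open>v\<^sub>-\<close> is the only case in which a merging or splitting map is zero on a basis element.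
\<close>
definition killed_at :: "nat set \<Rightarrow> marking \<Rightarrow> nat \<Rightarrow> bool" where
  "killed_at \<sigma> m b \<longleftrightarrow> mergetrace D \<sigma> b \<and> m (strand1 D \<sigma> b) = Vminus \<and> m (strand2 D \<sigma> b) = Vminus"

lemma insert_in_states: "\<sigma> \<in> states D \<Longrightarrow> c < n \<Longrightarrow> insert c \<sigma> \<in> states D"
  by (simp add: states_def)

text \<open>
  Different crossings \<open>b\<close> lead to different states \<open>insert b \<sigma>\<close>, so no cancellation is possible, and
  every edge map must vanish separately. For each other kind of 0-trace, a marking of the new state
  with coefficient \<open>1\<close> is written down.
\<close>
lemma state_cycle_iff:
  assumes es: "(\<sigma>, m) \<in> enhanced_states D"
  shows "state_cycle D (\<sigma>, m) \<longleftrightarrow> (\<forall>b\<in>traces0 D \<sigma>. killed_at \<sigma> m b)"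
proof
  assume all: "\<forall>b\<in>traces0 D \<sigma>. killed_at \<sigma> m b"
  have "differential D (basis_chain (\<sigma>, m)) t = 0" for t
  proof (cases t)
    case (Pair \<tau> m')
    have "diff_coeff D (\<sigma>, m) (\<tau>, m') = 0"
      by (rule diff_coeff_eq_0) (use all in \<open>simp add: killed_at_def edge_coeff_minus_minus\<close>)
    then show ?thesis by (simp add: differential_basis[OF es] Pair)
  qed
  then show "state_cycle D (\<sigma>, m)" using es by (auto simp: state_cycle_def)
next
  assume cyc: "state_cycle D (\<sigma>, m)"
  have \<sigma>: "\<sigma> \<in> states D" using es by (simp add: enhanced_states_def)
  have zero: "edge_coeff D b \<sigma> m m' = 0" if b: "b \<in> traces0 D \<sigma>" and m': "m' \<in> markings D (insert b \<sigma>)" for b m'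
  proof -
    have "(insert b \<sigma>, m') \<in> enhanced_states D"
      using m' insert_in_states[OF \<sigma>, of b] b by (simp add: enhanced_states_def traces0_def)
    then have "diff_coeff D (\<sigma>, m) (insert b \<sigma>, m') = 0"
      using cyc differential_basis[OF es, of "(insert b \<sigma>, m')"] by (simp add: state_cycle_def)
    then show ?thesis using diff_coeff_insert[OF b, of m m'] by simp
  qed
  show "\<forall>b\<in>traces0 D \<sigma>. killed_at \<sigma> m b"
  proof
    fix b assume b: "b \<in> traces0 D \<sigma>"
    then have bn: "b < n" "b \<notin> \<sigma>" by (auto simp: traces0_def)
    let ?\<tau> = "insert b \<sigma>"
    have mt: "mergetrace D \<sigma> b"
    proof (rule ccontr)
      assume "\<not> mergetrace D \<sigma> b"
      then obtain A B C where st: "merge_step ?\<tau> \<sigma> b A B C" using split_step_insert bn by blast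
      note s = merge_stepD[OF st]
      \<comment> \<open>The splitting map is injective, so it has some term \<open>(x, y)\<close>.\<close>
      obtain x y where xy: "(x, y) \<in> split_map (m C)" by (cases "m C") auto
      let ?m = "\<lambda>L. if L = A then x else if L = B then y else if L \<in> loops D ?\<tau> then m L else undefined"
      have "?m \<in> markings D ?\<tau>" using s(6,7) by (auto simp: markings_def)
      from zero[OF b this] show False using xy s(3) by (simp add: edge_coeff_split[OF st])
    qed
    then obtain A B C where st: "merge_step \<sigma> ?\<tau> b A B C" using merge_step_insert bn by blast
    note s = merge_stepD[OF st]
    have "merge_map (m A) (m B) = None"
    proof (rule ccontr)
      assume "merge_map (m A) (m B) \<noteq> None"
      then obtain x where x: "merge_map (m A) (m B) = Some x" by blast
      let ?m = "\<lambda>L. if L = C then x else if L \<in> loops D ?\<tau> then m L else undefined"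
      have "?m \<in> markings D ?\<tau>" using s(9) by (auto simp: markings_def)
      moreover have "\<forall>L\<in>loops D \<sigma> - {A, B}. ?m L = m L" using s(8,9) by auto
      ultimately show False using zero[OF b, of ?m] x by (simp add: edge_coeff_merge[OF st])
    qed
    then have "m A = Vminus" "m B = Vminus" by (cases "m A"; cases "m B"; simp)+
    then show "killed_at \<sigma> m b" using mt s(1,2) by (simp add: killed_at_def)
  qed
qed

lemma boundariesI: "y \<in> chains D \<Longrightarrow> differential D y = x \<Longrightarrow> x \<in> boundaries D"
  by (auto simp: boundaries_def)

lemma boundaries_scale: "x \<in> boundaries D \<Longrightarrow> (\<lambda>t. k * x t) \<in> boundaries D"
proof -
  assume "x \<in> boundaries D"
  then obtain y where y: "y \<in> chains D" "x = differential D y" by (auto simp: boundaries_def)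
  have "(\<lambda>s. k * y s) \<in> chains D" using y(1) by (simp add: chains_def)
  moreover have "differential D (\<lambda>s. k * y s) = (\<lambda>t. k * x t)"
    by (rule ext) (simp add: y(2) differential_def sum_distrib_left mult.assoc)
  ultimately show ?thesis by (rule boundariesI)
qed

lemma boundaries_add: "x \<in> boundaries D \<Longrightarrow> y \<in> boundaries D \<Longrightarrow> (\<lambda>t. x t + y t) \<in> boundaries D"
proof -
  assume "x \<in> boundaries D" "y \<in> boundaries D"
  then obtain u v where u: "u \<in> chains D" "x = differential D u" and v: "v \<in> chains D" "y = differential D v"
    by (auto simp: boundaries_def)
  have "(\<lambda>s. u s + v s) \<in> chains D" using u v by (simp add: chains_def)
  moreover have "differential D (\<lambda>s. u s + v s) = (\<lambda>t. x t + y t)"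
    by (rule ext) (simp add: u v differential_def sum.distrib distrib_right)
  ultimately show ?thesis by (rule boundariesI)
qed

lemma boundaries_combine:
  assumes "x \<in> boundaries D" "y \<in> boundaries D" "\<And>t. z t = k * x t + l * y t"
  shows "z \<in> boundaries D"
proof -
  have "(\<lambda>t. k * x t + l * y t) \<in> boundaries D"
    by (intro boundaries_add boundaries_scale assms)
  moreover have "z = (\<lambda>t. k * x t + l * y t)" using assms(3) by blast
  ultimately show ?thesis by simp
qed

lemma zero_in_boundaries: "(\<lambda>t. 0) \<in> boundaries D"
proof -
  have "(\<lambda>t. 0) \<in> chains D" "differential D (\<lambda>t. 0) = (\<lambda>t. 0)" by (auto simp: chains_def differential_def)
  then show ?thesis by (rule boundariesI)
qed

lemma homology_class_eqI:
  assumes "(\<lambda>t. x t - y t) \<in> boundaries D" shows "homology_class D x = homology_class D y"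
proof -
  have sub: "homology_class D x \<subseteq> homology_class D y" if xy: "(\<lambda>t. x t - y t) \<in> boundaries D" for x y
  proof
    fix z assume "z \<in> homology_class D x"
    then obtain b where b: "b \<in> boundaries D" "z = x + b" by (auto simp: homology_class_def)
    have "(\<lambda>t. (x t - y t) + b t) \<in> boundaries D" by (rule boundaries_add[OF xy b(1)])
    moreover have "z = y + (\<lambda>t. (x t - y t) + b t)" unfolding b(2) by (rule ext) simp
    ultimately show "z \<in> homology_class D y" unfolding homology_class_def by blast
  qed
  have "(\<lambda>t. y t - x t) \<in> boundaries D"
    by (rule boundaries_combine[OF assms assms, where k = "-1" and l = 0]) simp
  then show ?thesis using sub assms by blast
qed

lemma not_nontrivial: "basis_chain \<alpha> \<in> boundaries D \<Longrightarrow> \<not> nontrivial D \<alpha>"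
  unfolding nontrivial_def using homology_class_eqI[of "basis_chain \<alpha>" 0] by simp

text \<open>
  If all edge maps at \<open>(\<rho>, \<mu>)\<close> except the one at \<open>c\<close> vanish, then the differential of \<open>(\<rho>, \<mu>)\<close> is, up
  to the sign of the edge, the sum of the enhanced states with markings in \<open>S\<close>.
\<close>
lemma edge_image_in_boundaries:
  assumes es: "(\<rho>, \<mu>) \<in> enhanced_states D" and c: "c < n" "c \<notin> \<rho>"
    and coeff: "\<And>m'. m' \<in> markings D (insert c \<rho>) \<Longrightarrow> edge_coeff D c \<rho> \<mu> m' = of_bool (m' \<in> S)"
    and S: "S \<subseteq> markings D (insert c \<rho>)"
    and others: "\<And>b. b \<in> traces0 D (insert c \<rho>) \<Longrightarrow> killed_at \<rho> \<mu> b"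
  shows "(\<lambda>t. of_bool (fst t = insert c \<rho> \<and> snd t \<in> S)) \<in> boundaries D"
proof -
  define s :: rat where "s = (-1) ^ card {b \<in> \<rho>. b < c}"
  have s2: "s * s = 1" by (simp add: s_def power_mult_distrib[symmetric])
  have ct: "c \<in> traces0 D \<rho>" using c by (simp add: traces0_def)
  have \<rho>: "\<rho> \<in> states D" using es by (simp add: enhanced_states_def)
  have d: "differential D (basis_chain (\<rho>, \<mu>)) t = s * of_bool (fst t = insert c \<rho> \<and> snd t \<in> S)" for t
  proof (cases t)
    case (Pair \<tau> m')
    show ?thesis
    proof (cases "t \<in> enhanced_states D")
      case True
      have t: "differential D (basis_chain (\<rho>, \<mu>)) t = diff_coeff D (\<rho>, \<mu>) (\<tau>, m')"
        using True by (simp add: differential_basis[OF es] Pair)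
      show ?thesis
      proof (cases "\<tau> = insert c \<rho>")
        case eq: True
        then have "m' \<in> markings D (insert c \<rho>)" using True Pair by (simp add: enhanced_states_def)
        then show ?thesis using t eq diff_coeff_insert[OF ct, of \<mu> m'] coeff[of m']
          by (simp add: Pair s_def)
      next
        case False
        have "diff_coeff D (\<rho>, \<mu>) (\<tau>, m') = 0"
        proof (rule diff_coeff_eq_0)
          fix b assume b: "b \<in> traces0 D \<rho>" "\<tau> = insert b \<rho>"
          then have "b \<in> traces0 D (insert c \<rho>)" using False by (auto simp: traces0_def)
          then show "edge_coeff D b \<rho> \<mu> m' = 0"
            using others[of b] by (simp add: killed_at_def edge_coeff_minus_minus)
        qed
        then show ?thesis using t False by (simp add: Pair)
      qed
    next
      case False
      then have "\<not> (fst t = insert c \<rho> \<and> snd t \<in> S)"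
        using S insert_in_states[OF \<rho> c(1)] by (auto simp: enhanced_states_def Pair)
      then show ?thesis using False by (simp add: differential_basis[OF es])
    qed
  qed
  have "basis_chain (\<rho>, \<mu>) \<in> chains D" using es by (auto simp: chains_def basis_chain_def)
  then have "differential D (basis_chain (\<rho>, \<mu>)) \<in> boundaries D" by (simp add: boundaries_def)
  from boundaries_scale[OF this, of s]
  show ?thesis unfolding d mult.assoc[symmetric] s2 by simp
qed

lemma markings_eqI:
  "m \<in> markings D \<sigma> \<Longrightarrow> m' \<in> markings D \<sigma> \<Longrightarrow> (\<And>L. L \<in> loops D \<sigma> \<Longrightarrow> m' L = m L) \<Longrightarrow> m' = m"
  by (rule ext) (metis (mono_tags, lifting) markings_def mem_Collect_eq)

lemma state_cycleD:
  assumes "state_cycle D (\<sigma>, m)"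
  shows "(\<sigma>, m) \<in> enhanced_states D" "\<sigma> \<in> states D" "m \<in> markings D \<sigma>"
    "b \<in> traces0 D \<sigma> \<Longrightarrow> killed_at \<sigma> m b"
  using assms state_cycle_iff[of \<sigma> m] by (auto simp: state_cycle_def enhanced_states_def)

text \<open>
  The loop \<open>C\<close> with the 1-pinchtrace arises by merging two loops \<open>A\<close> and \<open>B\<close>. Marking \<open>A\<close> by the unit
  \<open>v\<^sub>+\<close> and \<open>B\<close> by the mark of \<open>C\<close> gives a primitive: since \<open>C\<close> meets no 0-trace, the 0-traces of \<open>\<sigma>\<close>
  still join the same loops with the same marks.
\<close>
lemma one_pinchtrace_boundary:
  assumes cyc: "state_cycle D (\<sigma>, m)" and c: "c \<in> traces1 D \<sigma>" and pin: "\<not> mergetrace D \<sigma> c"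
    and nz: "\<not> zero_tracing D \<sigma> (strand1 D \<sigma> c)"
  shows "basis_chain (\<sigma>, m) \<in> boundaries D"
proof -
  have cn: "c < n" "c \<in> \<sigma>" using c by (auto simp: traces1_def)
  let ?\<rho> = "\<sigma> - {c}"
  have ins: "insert c ?\<rho> = \<sigma>" using cn by auto
  obtain A B C where st: "merge_step ?\<rho> \<sigma> c A B C" using split_step_remove cn pin by blast
  note s = merge_stepD[OF st]
  note cy = state_cycleD[OF cyc]
  define \<mu> where "\<mu> = (\<lambda>L. if L = A then Vplus else if L = B then m C else if L \<in> loops D ?\<rho> then m L else undefined)"
  have es: "(?\<rho>, \<mu>) \<in> enhanced_states D"
    using cy(2) s(6,7) by (auto simp: enhanced_states_def states_def markings_def \<mu>_def)
  have coeff: "edge_coeff D c ?\<rho> \<mu> m' = of_bool (m' \<in> {m})" if m': "m' \<in> markings D (insert c ?\<rho>)" for m'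
  proof -
    have mu: "\<mu> A = Vplus" "\<mu> B = m C" using s(3) by (simp_all add: \<mu>_def)
    have "merge_map Vplus x = Some x" for x by (cases x) simp_all
    then have "edge_coeff D c ?\<rho> \<mu> m' = of_bool ((\<forall>L\<in>loops D ?\<rho> - {A, B}. m' L = \<mu> L) \<and> m' C = m C)"
      using edge_coeff_merge[of ?\<rho> c A B C \<mu> m'] st unfolding ins by (auto simp: mu)
    also have "(\<forall>L\<in>loops D ?\<rho> - {A, B}. m' L = \<mu> L) \<longleftrightarrow> (\<forall>L\<in>loops D ?\<rho> - {A, B}. m' L = m L)"
      by (simp add: \<mu>_def)
    also have "\<dots> \<and> m' C = m C \<longleftrightarrow> (\<forall>L\<in>loops D \<sigma>. m' L = m L)" unfolding s(9) by blast
    also have "\<dots> \<longleftrightarrow> m' \<in> {m}" using markings_eqI[OF cy(3), of m'] m' unfolding ins by auto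
    finally show ?thesis .
  qed
  have others: "killed_at ?\<rho> \<mu> b" if b: "b \<in> traces0 D (insert c ?\<rho>)" for b
  proof -
    have b': "b \<in> traces0 D \<sigma>" using b unfolding ins .
    have "strand1 D \<sigma> b \<noteq> C" "strand2 D \<sigma> b \<noteq> C"
      using nz b' unfolding zero_tracing_def trace_loops_def s(4) by auto
    then have eq: "strand1 D ?\<rho> b = strand1 D \<sigma> b" "strand2 D ?\<rho> b = strand2 D \<sigma> b"
      and ne: "strand1 D ?\<rho> b \<noteq> A" "strand1 D ?\<rho> b \<noteq> B" "strand2 D ?\<rho> b \<noteq> A" "strand2 D ?\<rho> b \<noteq> B"
      unfolding strand1_def strand2_def s(10) by presburger+
    have "b < n" using b' by (simp add: traces0_def)
    then show ?thesis using cy(4)[OF b'] ne strand_in_loops[of b ?\<rho>] unfolding killed_at_def mergetrace_def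
      by (simp add: \<mu>_def eq)
  qed
  have "(\<lambda>t. of_bool (fst t = insert c ?\<rho> \<and> snd t \<in> {m})) \<in> boundaries D"
    by (rule edge_image_in_boundaries[OF es cn(1) _ coeff _ others]) (use cy(3) ins in auto)
  moreover have "basis_chain (\<sigma>, m) = (\<lambda>t. of_bool (fst t = insert c ?\<rho> \<and> snd t \<in> {m}))"
    unfolding ins basis_chain_def by (rule ext) (simp add: prod_eq_iff)
  ultimately show ?thesis by simp
qed

text \<open>
  With \<open>c\<close> changed back to a 0-smoothing, \<open>A\<close> and \<open>B\<close> form one loop, which gets the mark \<open>x\<close>; the edge
  map at \<open>c\<close> splits it again. A 0-trace of \<open>\<sigma>\<close> still joins two distinct loops after \<open>A\<close> and \<open>B\<close> have
  been merged because it does not join \<open>A\<close> to \<open>B\<close>, and its loops are still marked \<open>v\<^sub>-\<close>, unless the new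
  loop is marked \<open>v\<^sub>+\<close> and touched by it.
\<close>
lemma split_image_boundary:
  assumes cyc: "state_cycle D (\<sigma>, m)" and c: "c \<in> traces1 D \<sigma>" and AB: "trace_loops D \<sigma> c = {A, B}" "A \<noteq> B"
    and only1: "\<And>b. b \<in> traces0 D \<sigma> \<Longrightarrow> trace_loops D \<sigma> b \<noteq> {A, B}"
    and x: "x = Vplus \<Longrightarrow> \<not> zero_tracing D \<sigma> A \<and> \<not> zero_tracing D \<sigma> B"
  shows "(\<lambda>t. of_bool (fst t = \<sigma> \<and> snd t \<in> {m' \<in> markings D \<sigma>.
    (\<forall>L\<in>loops D \<sigma> - {A, B}. m' L = m L) \<and> (m' A, m' B) \<in> split_map x})) \<in> boundaries D"
proof -
  have cn: "c < n" "c \<in> \<sigma>" using c by (auto simp: traces1_def)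
  let ?\<rho> = "\<sigma> - {c}"
  have ins: "insert c ?\<rho> = \<sigma>" using cn by auto
  have "mergetrace D \<sigma> c" using AB by (auto simp: mergetrace_def trace_loops_def doubleton_eq_iff)
  then obtain A' B' C where st: "merge_step \<sigma> ?\<rho> c A' B' C" using merge_step_remove cn by blast
  note s = merge_stepD[OF st]
  have "{A', B'} = {A, B}" using AB(1) s(1,2) by (simp add: trace_loops_def)
  then have swap: "A' = A \<and> B' = B \<or> A' = B \<and> B' = A" by (auto simp: doubleton_eq_iff)
  note cy = state_cycleD[OF cyc]
  define \<mu> where "\<mu> = (\<lambda>L. if L = C then x else if L \<in> loops D ?\<rho> then m L else undefined)"
  let ?S = "{m' \<in> markings D \<sigma>. (\<forall>L\<in>loops D \<sigma> - {A, B}. m' L = m L) \<and> (m' A, m' B) \<in> split_map x}"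
  have es: "(?\<rho>, \<mu>) \<in> enhanced_states D"
    using cy(2) s(9) by (auto simp: enhanced_states_def states_def markings_def \<mu>_def)
  have coeff: "edge_coeff D c ?\<rho> \<mu> m' = of_bool (m' \<in> ?S)" if m': "m' \<in> markings D (insert c ?\<rho>)" for m'
  proof -
    have "edge_coeff D c ?\<rho> \<mu> m' =
        of_bool ((\<forall>L\<in>loops D \<sigma> - {A', B'}. m' L = \<mu> L) \<and> (m' A', m' B') \<in> split_map (\<mu> C))"
      using edge_coeff_split[of c ?\<rho> A' B' C \<mu> m'] st unfolding ins by simp
    also have "\<mu> C = x" by (simp add: \<mu>_def)
    also have "(\<forall>L\<in>loops D \<sigma> - {A', B'}. m' L = \<mu> L) \<longleftrightarrow> (\<forall>L\<in>loops D \<sigma> - {A', B'}. m' L = m L)"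
      using s(8) by (auto simp: \<mu>_def s(9))
    also have "{A', B'} = {A, B}" by fact
    also have "(m' A', m' B') \<in> split_map x \<longleftrightarrow> (m' A, m' B) \<in> split_map x"
      using swap by (cases x) auto
    finally show ?thesis using m' unfolding ins by simp
  qed
  have others: "killed_at ?\<rho> \<mu> b" if b: "b \<in> traces0 D (insert c ?\<rho>)" for b
  proof -
    have b': "b \<in> traces0 D \<sigma>" using b unfolding ins .
    then have bn: "b < n" by (simp add: traces0_def)
    let ?f = "\<lambda>L. if L = A' \<or> L = B' then C else L"
    let ?P = "strand1 D \<sigma> b" and ?Q = "strand2 D \<sigma> b"
    have P: "?P \<in> loops D \<sigma>" "?Q \<in> loops D \<sigma>" using strand_in_loops[OF bn] by auto
    have PQ: "strand1 D ?\<rho> b = ?f ?P" "strand2 D ?\<rho> b = ?f ?Q"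
      unfolding strand1_def strand2_def s(10) by (rule refl)+
    have k: "?P \<noteq> ?Q" "m ?P = Vminus" "m ?Q = Vminus"
      using cy(4)[OF b'] by (simp_all add: killed_at_def mergetrace_def)
    have "{?P, ?Q} \<noteq> {A', B'}" using only1[OF b'] unfolding \<open>{A', B'} = {A, B}\<close> trace_loops_def .
    moreover have "?P \<noteq> C" "?Q \<noteq> C" using P s(8) by auto
    ultimately have ne: "?f ?P \<noteq> ?f ?Q" using k(1) by (auto simp: doubleton_eq_iff)
    \<comment> \<open>A 0-trace at \<open>A\<close> or \<open>B\<close> excludes \<open>x = v\<^sub>+\<close>, so that a merged loop touched by a 0-trace is marked \<open>v\<^sub>-\<close>.\<close>
    have touch: "x = Vminus" if "L = A' \<or> L = B'" "L \<in> {?P, ?Q}" for L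
    proof (cases x)
      case Vplus
      have "zero_tracing D \<sigma> L" using that(2) b' unfolding zero_tracing_def trace_loops_def by blast
      moreover have "L = A \<or> L = B" using that(1) swap by auto
      ultimately show ?thesis using x[OF Vplus] by blast
    qed
    have fm: "\<mu> (?f L) = Vminus" if "L \<in> {?P, ?Q}" for L
    proof (cases "L = A' \<or> L = B'")
      case True
      then have "?f L = C" by simp
      then show ?thesis using touch[OF True that] by (simp add: \<mu>_def)
    next
      case False
      then have "?f L = L" by simp
      moreover have "L \<in> loops D \<sigma>" "m L = Vminus" using that P k by auto
      moreover have "L \<in> loops D ?\<rho>" using False \<open>L \<in> loops D \<sigma>\<close> s(9) by simp
      moreover have "L \<noteq> C" using \<open>L \<in> loops D \<sigma>\<close> s(8) by auto
      ultimately show ?thesis by (simp add: \<mu>_def)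
    qed
    show ?thesis unfolding killed_at_def mergetrace_def PQ using ne fm[of ?P] fm[of ?Q] by blast
  qed
  have "(\<lambda>t. of_bool (fst t = insert c ?\<rho> \<and> snd t \<in> ?S)) \<in> boundaries D"
    by (rule edge_image_in_boundaries[OF es cn(1) _ coeff _ others]) (use ins in auto)
  then show ?thesis unfolding ins .
qed

lemma minus_pair_boundary:
  assumes cyc: "state_cycle D (\<sigma>, m)" and c: "c \<in> traces1 D \<sigma>" and AB: "trace_loops D \<sigma> c = {A, B}" "A \<noteq> B"
    and only1: "\<And>b. b \<in> traces0 D \<sigma> \<Longrightarrow> trace_loops D \<sigma> b \<noteq> {A, B}"
    and m: "m A = Vminus" "m B = Vminus"
  shows "basis_chain (\<sigma>, m) \<in> boundaries D"
proof -
  note cy = state_cycleD[OF cyc]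
  have "{m' \<in> markings D \<sigma>. (\<forall>L\<in>loops D \<sigma> - {A, B}. m' L = m L) \<and> (m' A, m' B) \<in> split_map Vminus} = {m}"
    (is "?S = _")
  proof
    show "{m} \<subseteq> ?S" using cy(3) m by simp
    show "?S \<subseteq> {m}"
    proof
      fix m' assume m': "m' \<in> ?S"
      have "m' = m" by (rule markings_eqI[OF cy(3)]) (use m' m in auto)
      then show "m' \<in> {m}" by simp
    qed
  qed
  moreover have "basis_chain (\<sigma>, m) = (\<lambda>t. of_bool (fst t = \<sigma> \<and> snd t \<in> {m}))"
    unfolding basis_chain_def by (rule ext) (simp add: prod_eq_iff)
  ultimately show ?thesis using split_image_boundary[OF cyc c AB only1, of Vminus] by simp
qed

text \<open>
  The two terms of the split of \<open>v\<^sub>+\<close> differ in the place of the \<open>v\<^sub>-\<close>, and their sum is a boundary.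
\<close>
lemma move_minus_boundary:
  assumes cyc: "state_cycle D (\<sigma>, m)" and c: "c \<in> traces1 D \<sigma>" and AB: "trace_loops D \<sigma> c = {A, B}" "A \<noteq> B"
    and nz: "\<not> zero_tracing D \<sigma> A" "\<not> zero_tracing D \<sigma> B"
    and m: "m A = Vminus" "m B = Vplus"
  shows "(\<lambda>t. basis_chain (\<sigma>, m) t + basis_chain (\<sigma>, m(A := Vplus, B := Vminus)) t) \<in> boundaries D"
proof -
  let ?m = "m(A := Vplus, B := Vminus)"
  note cy = state_cycleD[OF cyc]
  have cn: "c < n" using c by (simp add: traces1_def)
  have ABl: "A \<in> loops D \<sigma>" "B \<in> loops D \<sigma>"
    using strand_in_loops[OF cn, of \<sigma>] AB(1) unfolding trace_loops_def by (auto simp: doubleton_eq_iff)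
  have mm: "?m \<in> markings D \<sigma>" using cy(3) ABl by (auto simp: markings_def)
  have only1: "trace_loops D \<sigma> b \<noteq> {A, B}" if "b \<in> traces0 D \<sigma>" for b
    using nz(1) that unfolding zero_tracing_def by blast
  have "{m' \<in> markings D \<sigma>. (\<forall>L\<in>loops D \<sigma> - {A, B}. m' L = m L) \<and> (m' A, m' B) \<in> split_map Vplus} = {m, ?m}"
    (is "?S = _")
  proof
    show "{m, ?m} \<subseteq> ?S" using cy(3) mm m AB(2) by simp
    show "?S \<subseteq> {m, ?m}"
    proof
      fix m' assume m': "m' \<in> ?S"
      then consider "m' A = Vminus" "m' B = Vplus" | "m' A = Vplus" "m' B = Vminus" by auto
      then show "m' \<in> {m, ?m}"
      proof cases
        case 1
        have "m' = m" by (rule markings_eqI[OF cy(3)]) (use m' m 1 in auto)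
        then show ?thesis by simp
      next
        case 2
        have "m' = ?m" by (rule markings_eqI[OF mm]) (use m' 2 in auto)
        then show ?thesis by simp
      qed
    qed
  qed
  moreover have "(\<lambda>t. basis_chain (\<sigma>, m) t + basis_chain (\<sigma>, ?m) t) = (\<lambda>t. of_bool (fst t = \<sigma> \<and> snd t \<in> {m, ?m}))"
  proof
    have "?m A \<noteq> m A" using m AB(2) by simp
    then have "?m \<noteq> m" by metis
    then show "basis_chain (\<sigma>, m) t + basis_chain (\<sigma>, ?m) t = of_bool (fst t = \<sigma> \<and> snd t \<in> {m, ?m})" for t
      unfolding basis_chain_def by (cases t) auto
  qed
  ultimately show ?thesis using split_image_boundary[OF cyc c AB only1, of Vplus] nz by simp
qed

text \<open>
  Being a cycle depends only on the marks of 0-tracing loops, so marks in the 1-block may be changed.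
\<close>
lemma state_cycle_cong:
  assumes cyc: "state_cycle D (\<sigma>, m)" and m': "m' \<in> markings D \<sigma>"
    and eq: "\<And>L. L \<in> loops D \<sigma> \<Longrightarrow> zero_tracing D \<sigma> L \<Longrightarrow> m' L = m L"
  shows "state_cycle D (\<sigma>, m')"
proof -
  note cy = state_cycleD[OF cyc]
  have es: "(\<sigma>, m') \<in> enhanced_states D" using cy(2) m' by (simp add: enhanced_states_def)
  have "killed_at \<sigma> m' b" if b: "b \<in> traces0 D \<sigma>" for b
  proof -
    have "zero_tracing D \<sigma> (strand1 D \<sigma> b)" "zero_tracing D \<sigma> (strand2 D \<sigma> b)"
      using b unfolding zero_tracing_def trace_loops_def by auto
    moreover have "b < n" using b by (simp add: traces0_def)
    ultimately show ?thesis
      using cy(4)[OF b] eq strand_in_loops[of b \<sigma>] by (simp add: killed_at_def)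
  qed
  then show ?thesis using state_cycle_iff[OF es] by blast
qed

section \<open>Moving minus marks in the 1-block\<close>
lemma one_blockD:
  "L \<in> one_block D \<sigma> \<Longrightarrow> L \<in> loops D \<sigma>" "L \<in> one_block D \<sigma> \<Longrightarrow> \<not> zero_tracing D \<sigma> L"
  by (simp_all add: one_block_def)

lemma one_block_adjE:
  assumes "(A, B) \<in> one_block_adj D \<sigma>"
  obtains c where "c \<in> traces1 D \<sigma>" "trace_loops D \<sigma> c = {A, B}" "A \<in> one_block D \<sigma>" "B \<in> one_block D \<sigma>"
  using assms unfolding one_block_adj_def by blast

text \<open>
  Move the \<open>v\<^sub>-\<close> at \<open>A\<close> along a path towards the one at \<open>B\<close>. Each move changes only the sign of the
  class, and as soon as the next loop is itself marked \<open>v\<^sub>-\<close>, the two are adjacent and the class is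
  zero.
\<close>
lemma two_minus_boundary:
  assumes "state_cycle D (\<sigma>, m)" "(A, B) \<in> one_block_adj D \<sigma> ^^ k" "A \<noteq> B" "m A = Vminus" "m B = Vminus"
  shows "basis_chain (\<sigma>, m) \<in> boundaries D"
  using assms
proof (induction k arbitrary: A m)
  case 0 then show ?case by simp
next
  case (Suc k)
  from Suc.prems(2) obtain A1 where A1: "(A, A1) \<in> one_block_adj D \<sigma>" "(A1, B) \<in> one_block_adj D \<sigma> ^^ k"
    by (meson relpow_Suc_D2)
  from A1(1) obtain c where c: "c \<in> traces1 D \<sigma>" "trace_loops D \<sigma> c = {A, A1}"
    and bl: "A \<in> one_block D \<sigma>" "A1 \<in> one_block D \<sigma>" by (rule one_block_adjE)
  note nz = one_blockD(2)[OF bl(1)] one_blockD(2)[OF bl(2)]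
  consider "A1 = A" | "A1 \<noteq> A" "m A1 = Vminus" | "A1 \<noteq> A" "m A1 = Vplus" by (cases "m A1") auto
  then show ?case
  proof cases
    case 1
    then show ?thesis using Suc.IH[of m A] A1(2) Suc.prems by simp
  next
    case 2
    show ?thesis
    proof (rule minus_pair_boundary[OF Suc.prems(1) c])
      show "trace_loops D \<sigma> b \<noteq> {A, A1}" if "b \<in> traces0 D \<sigma>" for b
        using nz(1) that unfolding zero_tracing_def by blast
    qed (use 2 Suc.prems in auto)
  next
    case 3
    let ?m = "m(A := Vplus, A1 := Vminus)"
    have "?m \<in> markings D \<sigma>"
      using state_cycleD(3)[OF Suc.prems(1)] one_blockD(1)[OF bl(1)] one_blockD(1)[OF bl(2)]
      by (auto simp: markings_def)
    then have sc: "state_cycle D (\<sigma>, ?m)"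
      by (rule state_cycle_cong[OF Suc.prems(1)]) (use nz in auto)
    have ne: "A1 \<noteq> B" using 3 Suc.prems by auto
    have "?m A1 = Vminus" "?m B = Vminus" using ne Suc.prems(3,5) by simp_all
    then have "basis_chain (\<sigma>, ?m) \<in> boundaries D" by (rule Suc.IH[OF sc A1(2) ne])
    moreover have "(\<lambda>t. basis_chain (\<sigma>, m) t + basis_chain (\<sigma>, ?m) t) \<in> boundaries D"
      by (rule move_minus_boundary[OF Suc.prems(1) c]) (use 3 nz Suc.prems in auto)
    ultimately show ?thesis
      by (rule boundaries_combine[where k = "-1" and l = 1]) simp
  qed
qed

definition place_minus :: "marking \<Rightarrow> nat set set \<Rightarrow> nat set \<Rightarrow> marking" where
  "place_minus m K A = (\<lambda>L. if L \<in> K then (if L = A then Vminus else Vplus) else m L)"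

lemma only_minus_in_place: "only_minus_in K m L \<Longrightarrow> place_minus m K L = m"
  by (rule ext) (auto simp: only_minus_in_def place_minus_def)

lemma place_minus_state_cycle:
  assumes cyc: "state_cycle D (\<sigma>, m)" and K: "K \<subseteq> one_block D \<sigma>"
  shows "state_cycle D (\<sigma>, place_minus m K A)"
proof (rule state_cycle_cong[OF cyc])
  have "K \<subseteq> loops D \<sigma>" using K one_blockD(1) by blast
  then show "place_minus m K A \<in> markings D \<sigma>"
    using state_cycleD(3)[OF cyc] by (auto simp: markings_def place_minus_def)
  show "place_minus m K A L = m L" if "zero_tracing D \<sigma> L" for L
    using that K one_blockD(2) by (auto simp: place_minus_def)
qed

lemma place_minus_step:
  assumes cyc: "state_cycle D (\<sigma>, m)" and K: "K \<subseteq> one_block D \<sigma>"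
    and AB: "A \<in> K" "B \<in> K" "A \<noteq> B" and c: "c \<in> traces1 D \<sigma>" "trace_loops D \<sigma> c = {A, B}"
  shows "(\<lambda>t. basis_chain (\<sigma>, place_minus m K A) t + basis_chain (\<sigma>, place_minus m K B) t) \<in> boundaries D"
proof -
  have "A \<in> one_block D \<sigma>" "B \<in> one_block D \<sigma>" using AB K by auto
  then have "(\<lambda>t. basis_chain (\<sigma>, place_minus m K A) t +
      basis_chain (\<sigma>, (place_minus m K A)(A := Vplus, B := Vminus)) t) \<in> boundaries D"
    by (intro move_minus_boundary[OF place_minus_state_cycle[OF cyc K] c] AB one_blockD(2))
      (use AB in \<open>simp_all add: place_minus_def\<close>)
  moreover have "(place_minus m K A)(A := Vplus, B := Vminus) = place_minus m K B"
    by (rule ext) (use AB in \<open>simp add: place_minus_def\<close>)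
  ultimately show ?thesis by simp
qed

lemma component:
  assumes "K \<in> one_block_components D \<sigma>"
  shows "K \<subseteq> one_block D \<sigma>"
    and "A \<in> K \<Longrightarrow> (A, B) \<in> one_block_adj D \<sigma> \<Longrightarrow> B \<in> K"
    and "A \<in> K \<Longrightarrow> B \<in> K \<Longrightarrow> (A, B) \<in> (one_block_adj D \<sigma>)\<^sup>*"
proof -
  let ?R = "one_block_adj D \<sigma>"
  have sym: "?R\<inverse> = ?R" unfolding one_block_adj_def by (auto simp: insert_commute)
  obtain L0 where L0: "L0 \<in> one_block D \<sigma>" "K = gen_class ?R L0"
    using assms by (auto simp: one_block_components_def gen_classes_def)
  show "K \<subseteq> one_block D \<sigma>" unfolding L0(2)
    by (rule gen_class_closed_subset[OF L0(1)]) (simp add: one_block_adj_def)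
  show "A \<in> K \<Longrightarrow> (A, B) \<in> ?R \<Longrightarrow> B \<in> K" unfolding L0(2) by (rule gen_class_step[OF disjI1])
  assume "A \<in> K" "B \<in> K"
  then have "gen_class ?R A = K" unfolding L0(2) by (simp add: gen_class_eq)
  then have "B \<in> gen_class ?R A" using \<open>B \<in> K\<close> by simp
  then show "(A, B) \<in> ?R\<^sup>*" unfolding gen_class_def sym by simp
qed

text \<open>
  A step of the walk that stays at its loop, along a 1-pinchtrace, leaves the sign as it is; hence the
  sign is not simply determined by the length of the walk.
\<close>
lemma place_minus_walk:
  assumes cyc: "state_cycle D (\<sigma>, m)" and K: "K \<in> one_block_components D \<sigma>"
    and A: "A \<in> K" and AB: "(A, B) \<in> (one_block_adj D \<sigma>)\<^sup>*"
  shows "B \<in> K \<and> (\<exists>s::rat. (s = 1 \<or> s = -1) \<and>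
    (\<lambda>t. basis_chain (\<sigma>, place_minus m K A) t - s * basis_chain (\<sigma>, place_minus m K B) t) \<in> boundaries D)"
  using AB
proof induction
  case base
  show ?case using A zero_in_boundaries by (intro conjI exI[of _ 1]) simp_all
next
  case (step B C)
  then obtain s :: rat where s: "s = 1 \<or> s = -1"
    "(\<lambda>t. basis_chain (\<sigma>, place_minus m K A) t - s * basis_chain (\<sigma>, place_minus m K B) t) \<in> boundaries D"
    and B: "B \<in> K" by blast
  have C: "C \<in> K" using component(2)[OF K B step(2)] .
  show ?case
  proof (cases "B = C")
    case True then show ?thesis using s C by blast
  next
    case False
    obtain c where c: "c \<in> traces1 D \<sigma>" "trace_loops D \<sigma> c = {B, C}" using step(2) by (rule one_block_adjE)
    have "(\<lambda>t. basis_chain (\<sigma>, place_minus m K B) t + basis_chain (\<sigma>, place_minus m K C) t) \<in> boundaries D"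
      by (rule place_minus_step[OF cyc component(1)[OF K] B C False c])
    from s(2) this
    have "(\<lambda>t. basis_chain (\<sigma>, place_minus m K A) t - (- s) * basis_chain (\<sigma>, place_minus m K C) t) \<in> boundaries D"
      by (rule boundaries_combine[where k = 1 and l = s]) (simp add: algebra_simps)
    moreover have "- s = 1 \<or> - s = -1" using s(1) by auto
    ultimately show ?thesis using C by blast
  qed
qed

text \<open>
  After an odd number of moves, the class has changed its sign, but the marking is the original one.
\<close>
lemma odd_circuit_boundary:
  assumes cyc: "state_cycle D (\<sigma>, m)" and K: "K \<subseteq> one_block D \<sigma>"
    and circ: "circuit_in D \<sigma> K Ls cs" "odd (length cs)"
    and nopinch: "\<And>c. c \<in> set cs \<Longrightarrow> mergetrace D \<sigma> c"
  shows "basis_chain (\<sigma>, place_minus m K (hd Ls)) \<in> boundaries D"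
proof -
  have len: "length Ls = Suc (length cs)" and hl: "hd Ls = last Ls" and LK: "set Ls \<subseteq> K"
    and cs: "set cs \<subseteq> traces1 D \<sigma>" and tr: "\<And>t. t < length cs \<Longrightarrow> trace_loops D \<sigma> (cs ! t) = {Ls ! t, Ls ! Suc t}"
    using circ(1) unfolding circuit_in_def by auto
  let ?P = "\<lambda>i t. basis_chain (\<sigma>, place_minus m K (Ls ! i)) t"
  have "(\<lambda>t. ?P 0 t - (-1) ^ i * ?P i t) \<in> boundaries D" if "i \<le> length cs" for i
    using that
  proof (induction i)
    case 0 show ?case using zero_in_boundaries by simp
  next
    case (Suc i)
    have i: "i < length cs" using Suc.prems by simp
    have "mergetrace D \<sigma> (cs ! i)" using i nopinch by simp
    then have ne: "Ls ! i \<noteq> Ls ! Suc i"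
      using tr[OF i] by (auto simp: mergetrace_def trace_loops_def doubleton_eq_iff)
    have "Ls ! i \<in> K" "Ls ! Suc i \<in> K" using LK len i by (auto simp: subset_iff)
    moreover have "cs ! i \<in> traces1 D \<sigma>" using cs i by auto
    ultimately have "(\<lambda>t. ?P i t + ?P (Suc i) t) \<in> boundaries D"
      by (intro place_minus_step[OF cyc K _ _ ne _ tr[OF i]])
    with Suc.IH show ?case
      by (rule boundaries_combine[where k = 1 and l = "(-1) ^ i"]) (use i in \<open>simp_all add: algebra_simps\<close>)
  qed
  from this[OF order_refl] have "(\<lambda>t. ?P 0 t + ?P (length cs) t) \<in> boundaries D" using circ(2) by simp
  moreover have "Ls ! length cs = hd Ls" "Ls ! 0 = hd Ls"
    using len hl by (simp_all add: hd_conv_nth last_conv_nth flip: length_greater_0_conv)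
  ultimately have "(\<lambda>t. ?P 0 t + ?P 0 t) \<in> boundaries D" by simp
  \<comment> \<open>Dividing by two uses the rational coefficients.\<close>
  from this this have "(\<lambda>t. ?P 0 t) \<in> boundaries D"
    by (rule boundaries_combine[where k = "1/2" and l = 0]) simp
  then show ?thesis using \<open>Ls ! 0 = hd Ls\<close> by simp
qed

lemma unique_minus_in_component:
  assumes cyc: "state_cycle D (\<sigma>, m)" and nb: "basis_chain (\<sigma>, m) \<notin> boundaries D"
    and K: "K \<in> one_block_components D \<sigma>" and L: "L \<in> K" "m L = Vminus"
  shows "only_minus_in K m L"
proof -
  have "m L' = Vplus" if L': "L' \<in> K" "L' \<noteq> L" for L'
  proof (rule ccontr)
    assume "m L' \<noteq> Vplus"
    then have "m L' = Vminus" by (cases "m L'") auto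
    moreover obtain k where "(L, L') \<in> one_block_adj D \<sigma> ^^ k"
      using component(3)[OF K L(1) L'(1)] rtrancl_imp_relpow by blast
    ultimately show False using two_minus_boundary[OF cyc, of L L' k] L L' nb by blast
  qed
  then show ?thesis using L by (auto simp: only_minus_in_def)
qed

lemma odd_component_boundary:
  assumes cyc: "state_cycle D (\<sigma>, m)" and K: "K \<in> one_block_components D \<sigma>"
    and odd: "odd_component D \<sigma> K" and L: "only_minus_in K m L"
    and nopinch: "\<And>c. c \<in> traces1 D \<sigma> \<Longrightarrow> \<not> mergetrace D \<sigma> c \<Longrightarrow> trace_loops D \<sigma> c \<inter> one_block D \<sigma> = {}"
  shows "basis_chain (\<sigma>, m) \<in> boundaries D"
proof -
  note KB = component(1)[OF K]
  obtain Ls cs where circ: "circuit_in D \<sigma> K Ls cs" "odd (length cs)"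
    using odd unfolding odd_component_def even_component_def by blast
  have len: "length Ls = Suc (length cs)" and LK: "set Ls \<subseteq> K" and cs: "set cs \<subseteq> traces1 D \<sigma>"
    and tr: "\<forall>t<length cs. trace_loops D \<sigma> (cs ! t) = {Ls ! t, Ls ! Suc t}"
    using circ(1) unfolding circuit_in_def by auto
  have mt: "mergetrace D \<sigma> c" if c: "c \<in> set cs" for c
  proof (rule ccontr)
    assume "\<not> mergetrace D \<sigma> c"
    then have none: "trace_loops D \<sigma> c \<inter> one_block D \<sigma> = {}" using nopinch c cs by blast
    obtain t where t: "t < length cs" "c = cs ! t" using c by (auto simp: in_set_conv_nth)
    then have "Ls ! t \<in> trace_loops D \<sigma> c" using tr by simp
    moreover have "Ls ! t \<in> one_block D \<sigma>" using t len LK KB by (auto simp: subset_iff)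
    ultimately show False using none by blast
  qed
  have h: "hd Ls \<in> K" using len LK by (cases Ls) auto
  have LinK: "L \<in> K" using L by (simp add: only_minus_in_def)
  obtain s :: rat where
    "(\<lambda>t. basis_chain (\<sigma>, place_minus m K L) t - s * basis_chain (\<sigma>, place_minus m K (hd Ls)) t) \<in> boundaries D"
    using place_minus_walk[OF cyc K LinK component(3)[OF K LinK h]] by blast
  moreover have "basis_chain (\<sigma>, place_minus m K (hd Ls)) \<in> boundaries D"
    by (rule odd_circuit_boundary[OF cyc KB circ]) (rule mt)
  ultimately have "basis_chain (\<sigma>, place_minus m K L) \<in> boundaries D"
    by (rule boundaries_combine[where k = 1 and l = s]) (simp add: algebra_simps)
  then show ?thesis using only_minus_in_place[OF L] by simp
qed

lemma nontrivial_state_cycle: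
  assumes cyc: "state_cycle D (\<sigma>, m)" and nt: "nontrivial D (\<sigma>, m)"
  shows "zero_merging D \<sigma>"
    and "\<forall>c\<in>traces1 D \<sigma>. pinchtrace D \<sigma> c \<longrightarrow> trace_loops D \<sigma> c \<inter> one_block D \<sigma> = {}"
    and "\<forall>L\<in>loops D \<sigma>. zero_tracing D \<sigma> L \<longrightarrow> m L = Vminus"
    and "no_minus_pair_joined_by_only_1_traces D \<sigma> m"
    and "\<forall>K\<in>one_block_components D \<sigma>. odd_component D \<sigma> K \<longrightarrow> (\<forall>L\<in>K. m L = Vplus)"
    and "\<forall>K\<in>one_block_components D \<sigma>. even_component D \<sigma> K \<longrightarrow>
          (\<forall>L\<in>K. m L = Vplus) \<or> (\<exists>L. only_minus_in K m L)"
proof -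
  note cy = state_cycleD[OF cyc]
  have nb: "basis_chain (\<sigma>, m) \<notin> boundaries D" using nt not_nontrivial by blast
  show "zero_merging D \<sigma>" using cy(4) by (simp add: zero_merging_def killed_at_def)
  show pinch: "\<forall>c\<in>traces1 D \<sigma>. pinchtrace D \<sigma> c \<longrightarrow> trace_loops D \<sigma> c \<inter> one_block D \<sigma> = {}"
  proof (intro ballI impI)
    fix c assume c: "c \<in> traces1 D \<sigma>" "pinchtrace D \<sigma> c"
    then have eq: "strand1 D \<sigma> c = strand2 D \<sigma> c" by (simp add: pinchtrace_def)
    then have "\<not> mergetrace D \<sigma> c" by (simp add: mergetrace_def)
    then have "zero_tracing D \<sigma> (strand1 D \<sigma> c)" using one_pinchtrace_boundary[OF cyc c(1)] nb by blast
    then show "trace_loops D \<sigma> c \<inter> one_block D \<sigma> = {}"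
      using one_blockD(2) unfolding trace_loops_def eq by auto
  qed
  show "\<forall>L\<in>loops D \<sigma>. zero_tracing D \<sigma> L \<longrightarrow> m L = Vminus"
    using cy(4) by (auto simp: zero_tracing_def trace_loops_def killed_at_def)
  show "no_minus_pair_joined_by_only_1_traces D \<sigma> m"
    unfolding no_minus_pair_joined_by_only_1_traces_def
  proof
    assume "\<exists>A\<in>loops D \<sigma>. \<exists>B\<in>loops D \<sigma>. A \<noteq> B \<and> m A = Vminus \<and> m B = Vminus \<and> joined_by_only_1_traces D \<sigma> A B"
    then obtain A B where AB: "A \<noteq> B" "m A = Vminus" "m B = Vminus" and j: "joined_by_only_1_traces D \<sigma> A B"
      by blast
    from j obtain c where c: "c < n" "trace_loops D \<sigma> c = {A, B}" unfolding joined_by_only_1_traces_def by blast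
    have only: "b \<in> traces1 D \<sigma>" if "b < n" "trace_loops D \<sigma> b = {A, B}" for b
      using j that unfolding joined_by_only_1_traces_def by blast
    have "basis_chain (\<sigma>, m) \<in> boundaries D"
    proof (rule minus_pair_boundary[OF cyc only[OF c] c(2) AB(1)])
      show "trace_loops D \<sigma> b \<noteq> {A, B}" if "b \<in> traces0 D \<sigma>" for b
        using only[of b] that by (auto simp: traces0_def traces1_def)
    qed (use AB in auto)
    then show False using nb by blast
  qed
  have vp: "m L \<noteq> Vminus \<Longrightarrow> m L = Vplus" for L by (cases "m L") auto
  show "\<forall>K\<in>one_block_components D \<sigma>. odd_component D \<sigma> K \<longrightarrow> (\<forall>L\<in>K. m L = Vplus)"
  proof (intro ballI impI)
    fix K L assume K: "K \<in> one_block_components D \<sigma>" "odd_component D \<sigma> K" and L: "L \<in> K"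
    show "m L = Vplus"
    proof (rule vp, rule notI)
      assume "m L = Vminus"
      then have "only_minus_in K m L" by (rule unique_minus_in_component[OF cyc nb K(1) L])
      then have "basis_chain (\<sigma>, m) \<in> boundaries D"
        by (rule odd_component_boundary[OF cyc K]) (use pinch in \<open>simp add: pinchtrace_def mergetrace_def\<close>)
      then show False using nb by blast
    qed
  qed
  show "\<forall>K\<in>one_block_components D \<sigma>. even_component D \<sigma> K \<longrightarrow>
          (\<forall>L\<in>K. m L = Vplus) \<or> (\<exists>L. only_minus_in K m L)"
    using unique_minus_in_component[OF cyc nb] vp by blast
qed

lemma change_minus_loop:
  assumes cyc: "state_cycle D (\<sigma>, m)" and K: "K \<in> one_block_components D \<sigma>"
    and L: "only_minus_in K m L" and L': "L' \<in> K"
  shows "state_cycle D (\<sigma>, m(L := Vplus, L' := Vminus))"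
    and "homology_class D (basis_chain (\<sigma>, m(L := Vplus, L' := Vminus))) = homology_class D (basis_chain (\<sigma>, m)) \<or>
      homology_class D (basis_chain (\<sigma>, m(L := Vplus, L' := Vminus))) = homology_class D (- basis_chain (\<sigma>, m))"
proof -
  let ?m = "m(L := Vplus, L' := Vminus)"
  have LK: "L \<in> K" using L by (simp add: only_minus_in_def)
  have m': "?m = place_minus m K L'"
  proof
    fix M
    have "m M = Vplus" if "M \<in> K" "M \<noteq> L" using L that by (simp add: only_minus_in_def)
    then show "?m M = place_minus m K L' M" using L' LK by (simp add: place_minus_def)
  qed
  show "state_cycle D (\<sigma>, ?m)" unfolding m' by (rule place_minus_state_cycle[OF cyc component(1)[OF K]])
  obtain s :: rat where s: "s = 1 \<or> s = -1"
    and b: "(\<lambda>t. basis_chain (\<sigma>, m) t - s * basis_chain (\<sigma>, ?m) t) \<in> boundaries D"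
    using place_minus_walk[OF cyc K LK component(3)[OF K LK L']] unfolding only_minus_in_place[OF L] m' by blast
  have b': "(\<lambda>t. basis_chain (\<sigma>, ?m) t - s * basis_chain (\<sigma>, m) t) \<in> boundaries D"
    by (rule boundaries_combine[OF b b, where k = "- s" and l = 0]) (use s in auto)
  from s show "homology_class D (basis_chain (\<sigma>, ?m)) = homology_class D (basis_chain (\<sigma>, m)) \<or>
      homology_class D (basis_chain (\<sigma>, ?m)) = homology_class D (- basis_chain (\<sigma>, m))"
  proof
    assume "s = 1"
    then show ?thesis using b' by (intro disjI1 homology_class_eqI) simp
  next
    assume "s = -1"
    then show ?thesis using b' by (intro disjI2 homology_class_eqI) simp
  qed
qed

end

theorem theorem4p8:
  fixes D :: link_diagram and \<sigma> :: "nat set" and m :: marking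
  assumes "oriented_link_diagram D"
    and "state_cycle D (\<sigma>, m)"
  shows
    "(nontrivial D (\<sigma>, m) \<longrightarrow>
       zero_merging D \<sigma> \<and>
       (\<forall>c\<in>traces1 D \<sigma>. pinchtrace D \<sigma> c \<longrightarrow> trace_loops D \<sigma> c \<inter> one_block D \<sigma> = {}) \<and>
       (\<forall>L\<in>loops D \<sigma>. zero_tracing D \<sigma> L \<longrightarrow> m L = Vminus) \<and>
       no_minus_pair_joined_by_only_1_traces D \<sigma> m \<and>
       (\<forall>K\<in>one_block_components D \<sigma>. odd_component D \<sigma> K \<longrightarrow> (\<forall>L\<in>K. m L = Vplus)) \<and>
       (\<forall>K\<in>one_block_components D \<sigma>. even_component D \<sigma> K \<longrightarrow>
          (\<forall>L\<in>K. m L = Vplus) \<or> (\<exists>L. only_minus_in K m L)))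
     \<and>
     (\<forall>K\<in>one_block_components D \<sigma>. \<forall>L L' m'.
        even_component D \<sigma> K \<longrightarrow> only_minus_in K m L \<longrightarrow> L' \<in> K \<longrightarrow>
        m' = m(L := Vplus, L' := Vminus) \<longrightarrow>
        no_minus_pair_joined_by_only_1_traces D \<sigma> m' \<longrightarrow>
        state_cycle D (\<sigma>, m') \<and>
        (homology_class D (basis_chain (\<sigma>, m')) = homology_class D (basis_chain (\<sigma>, m)) \<or>
         homology_class D (basis_chain (\<sigma>, m')) = homology_class D (- basis_chain (\<sigma>, m))))"
proof -
  interpret diagram D by unfold_locales (rule assms(1))
  show ?thesis
  proof (intro conjI impI ballI allI)
    fix K L L' m'
    assume K: "K \<in> one_block_components D \<sigma>" and L: "only_minus_in K m L" "L' \<in> K"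
      and m': "m' = m(L := Vplus, L' := Vminus)"
    note change = change_minus_loop[OF assms(2) K L]
    show "state_cycle D (\<sigma>, m')" unfolding m' by (rule change(1))
    show "homology_class D (basis_chain (\<sigma>, m')) = homology_class D (basis_chain (\<sigma>, m)) \<or>
        homology_class D (basis_chain (\<sigma>, m')) = homology_class D (- basis_chain (\<sigma>, m))"
      unfolding m' by (rule change(2))
  qed (use nontrivial_state_cycle[OF assms(2)] in blast)+
qed

end
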